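(* Let $k$ be a field of characteristic $0$ containing all roots of unity, let $d\geq 1$ be an integer, and let $R=R(k,d)=\varinjlim_i R_i$ be the direct limit ring constructed from $k$ and $d$ as in the context. Then $R$ is a $\mathbb{Q}^d$-graded field (with the grading described in the context), and $R$ is a Noetherian ring.
   Context: All rings are commutative with identity. A $G$-graded ring is a ring $R=\bigoplus_{g\in G}R_g$ with $R_gR_h\subset R_{g+h}$; it is a $G$-graded field if its only homogeneous ideals are $0$ and $R$ (with $R\ne 0$), equivalently if $R\neq 0$ and every nonzero homogeneous element is invertible. "Noetherian" means Noetherian as an ungraded ring. Construction of $R(k,d)$: let $k$ be a field of characteristic $0$ and $d\geq 1$. Fix a sequence of prime numbers $(p_i)_{i\geq 1}$ such that $\mathbb{Q}=\varinjlim_i \frac{1}{p_1p_2\cdots p_i}\mathbb{Z}$ (i.e. $\mathbb{Q}=\bigcup_i \frac{1}{p_1\cdots p_i}\mathbb{Z}$). Let $\alpha_{j,i}$ ($1\leq j\leq d$, $i\geq 1$) be indeterminates over $k$, $K=k(\alpha_{j,i}:1\leq j\leq d, i\geq 1)$, and for $i\geq 1$ let $R_i=K[t_{1,i},\ldots,t_{d,i},t_{1,i}^{-1},\ldots,t_{d,i}^{-1}]$ be the Laurent polynomial ring in $d$ variables over $K$. Let $\phi_i:R_i\to R_{i+1}$ be the $K$-algebra homomorphism with $\phi_i(t_{j,i})=\alpha_{j,i+1}^{-1}t_{j,i+1}^{p_i}$ for $1\leq j\leq d$. Set $R(k,d)=\varinjlim_i R_i$ along the maps $\phi_i$. The grading: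 with $e_1,\ldots,e_d$ the standard basis of $\mathbb{Q}^d$, elements of $K$ have degree $0$ and $\deg(t_{j,i})=\frac{1}{p_1\cdots p_{i-1}}e_j$ (so $\deg t_{j,1}=e_j$); the maps $\phi_i$ preserve degrees. *)

theory Defs
  imports
    "HOL-Algebra.Ring_Divisibility"
    "HOL-Algebra.Algebraic_Closure_Type"
    "HOL-Analysis.Finite_Cartesian_Product"
    "HOL-Library.Poly_Mapping"
    "HOL-Library.Product_Lexorder"
    "HOL-Computational_Algebra.Fraction_Field"
begin

section \<open>Graded rings and graded fields\<close>

locale graded_ring = cring R for R (structure) +
  fixes A :: "'g::ab_group_add \<Rightarrow> 'a set"
  assumes component_subgroup: "additive_subgroup (A g) R"
    and component_mult: "x \<in> A g \<Longrightarrow> y \<in> A h \<Longrightarrow> x \<otimes> y \<in> A (g + h)"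
    and component_direct_sum: "x \<in> carrier R \<Longrightarrow>
      \<exists>!f. finite {g. f g \<noteq> \<zero>} \<and> (\<forall>g. f g \<in> A g) \<and> x = (\<Oplus>g\<in>{g. f g \<noteq> \<zero>}. f g)"

definition homogeneous_ideal :: "('a, 'm) ring_scheme \<Rightarrow> ('g \<Rightarrow> 'a set) \<Rightarrow> 'a set \<Rightarrow> bool" where
  "homogeneous_ideal R A I \<longleftrightarrow> ideal I R \<and> (\<exists>S \<subseteq> (\<Union>g. A g). I = genideal R S)"

locale graded_field = graded_ring +
  assumes one_neq_zero: "\<one> \<noteq> \<zero>"
    and homogeneous_ideals: "homogeneous_ideal R A I \<Longrightarrow> I = {\<zero>} \<or> I = carrier R"


section \<open>Direct limits of sequences of commutative rings\<close>

text \<open>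
  The system consists of a ring type (the ring at every stage) and transition maps
  \<open>\<phi> n\<close> from stage \<open>n\<close> to stage \<open>n + 1\<close>. Elements of the limit are
  equivalence classes of pairs \<open>(n, x)\<close>, with \<open>x\<close> an element of stage \<open>n\<close>.
\<close>

fun transition :: "(nat \<Rightarrow> 'a \<Rightarrow> 'a) \<Rightarrow> nat \<Rightarrow> nat \<Rightarrow> 'a \<Rightarrow> 'a" where
  "transition \<phi> n 0 x = x"
| "transition \<phi> n (Suc m) x = \<phi> (n + m) (transition \<phi> n m x)"

definition dirlim_rel :: "(nat \<Rightarrow> 'a \<Rightarrow> 'a) \<Rightarrow> ((nat \<times> 'a) \<times> (nat \<times> 'a)) set" where
  "dirlim_rel \<phi> = {((n, x), (m, y)) | n x m y.
     \<exists>a b. n + a = m + b \<and> transition \<phi> n a x = transition \<phi> m b y}"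

definition dirlim_class :: "(nat \<Rightarrow> 'a \<Rightarrow> 'a) \<Rightarrow> nat \<Rightarrow> 'a \<Rightarrow> (nat \<times> 'a) set" where
  "dirlim_class \<phi> n x = dirlim_rel \<phi> `` {(n, x)}"

text \<open>
  Two classes are multiplied (added) by choosing representatives at a common stage; all such
  choices yield equivalent results, see \<open>dirlim_mult\<close> and \<open>dirlim_add\<close> below.
\<close>

definition dirlim :: "(nat \<Rightarrow> 'a::comm_ring_1 \<Rightarrow> 'a) \<Rightarrow> (nat \<times> 'a) set ring" where
  "dirlim \<phi> = \<lparr>
     carrier = UNIV // dirlim_rel \<phi>,
     monoid.mult = (\<lambda>C D. dirlim_rel \<phi> `` {(n, x * y) | n x y. (n, x) \<in> C \<and> (n, y) \<in> D}),
     one = dirlim_class \<phi> 0 1,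
     ring.zero = dirlim_class \<phi> 0 0,
     add = (\<lambda>C D. dirlim_rel \<phi> `` {(n, x + y) | n x y. (n, x) \<in> C \<and> (n, y) \<in> D})\<rparr>"

lemma transition_add:
  "transition \<phi> n (a + b) x = transition \<phi> (n + a) b (transition \<phi> n a x)"
  by (induction b) (auto simp: add.assoc)

lemma equiv_dirlim_rel: "equiv UNIV (dirlim_rel \<phi>)"
proof (rule equivI)
  show "refl (dirlim_rel \<phi>)"
    by (auto simp: refl_on_def dirlim_rel_def)
  show "sym (dirlim_rel \<phi>)"
    by (rule symI) (auto simp: dirlim_rel_def, metis)
  show "trans (dirlim_rel \<phi>)"
  proof (rule transI)
    fix u v w assume uv: "(u, v) \<in> dirlim_rel \<phi>" and vw: "(v, w) \<in> dirlim_rel \<phi>"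
    obtain n x where u: "u = (n, x)" by force
    obtain m y where v: "v = (m, y)" by force
    obtain l z where w: "w = (l, z)" by force
    obtain a b where ab: "n + a = m + b" "transition \<phi> n a x = transition \<phi> m b y"
      using uv by (auto simp: u v dirlim_rel_def)
    obtain c d where cd: "m + c = l + d" "transition \<phi> m c y = transition \<phi> l d z"
      using vw by (auto simp: v w dirlim_rel_def)
    have "transition \<phi> n (a + c) x = transition \<phi> m (b + c) y"
      by (simp only: transition_add ab)
    also have "\<dots> = transition \<phi> m (c + b) y"
      by (simp only: add.commute)
    also have "\<dots> = transition \<phi> l (d + b) z"
      by (simp only: transition_add cd)
    finally have "transition \<phi> n (a + c) x = transition \<phi> l (d + b) z" .
    moreover have "n + (a + c) = l + (d + b)"
      using ab(1) cd(1) by linarith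
    ultimately show "(u, w) \<in> dirlim_rel \<phi>"
      unfolding u w dirlim_rel_def by blast
  qed
qed auto

lemma dirlim_op:
  assumes "\<And>n x y. \<phi> n (f x y) = f (\<phi> n x) (\<phi> n y)"
  shows "dirlim_rel \<phi> `` {(m, f u v) | m u v.
           (m, u) \<in> dirlim_class \<phi> n x \<and> (m, v) \<in> dirlim_class \<phi> n y} =
         dirlim_class \<phi> n (f x y)"
proof -
  have tr: "transition \<phi> n a (f x y) = f (transition \<phi> n a x) (transition \<phi> n a y)" for n a x y
    by (induction a) (simp_all add: assms)
  have rel: "((n, f x y), (m, f u v)) \<in> dirlim_rel \<phi>"
    if xu: "(m, u) \<in> dirlim_class \<phi> n x" and yv: "(m, v) \<in> dirlim_class \<phi> n y" for m u v
  proof -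
    obtain a b where ab: "n + a = m + b" "transition \<phi> n a x = transition \<phi> m b u"
      using xu by (auto simp: dirlim_class_def dirlim_rel_def)
    obtain c d where cd: "n + c = m + d" "transition \<phi> n c y = transition \<phi> m d v"
      using yv by (auto simp: dirlim_class_def dirlim_rel_def)
    have e: "b + c = d + a"
      using ab(1) cd(1) by linarith
    have "n + (a + c) = m + (b + c)"
      using ab(1) by linarith
    moreover have "transition \<phi> n (a + c) x = transition \<phi> m (b + c) u"
      by (simp only: transition_add ab)
    moreover have "transition \<phi> n (c + a) y = transition \<phi> m (d + a) v"
      by (simp only: transition_add cd)
    ultimately have "n + (a + c) = m + (b + c) \<and>
        transition \<phi> n (a + c) (f x y) = transition \<phi> m (b + c) (f u v)"
      unfolding tr e by (simp add: add.commute)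
    thus ?thesis
      unfolding dirlim_rel_def by blast
  qed
  let ?S = "{(m, f u v) | m u v. (m, u) \<in> dirlim_class \<phi> n x \<and> (m, v) \<in> dirlim_class \<phi> n y}"
  have self: "(n, z) \<in> dirlim_class \<phi> n z" for z
    using equiv_class_self[OF equiv_dirlim_rel] by (auto simp: dirlim_class_def)
  have sub: "?S \<subseteq> dirlim_class \<phi> n (f x y)"
    using rel by (auto simp: dirlim_class_def)
  show ?thesis
  proof
    show "dirlim_rel \<phi> `` ?S \<subseteq> dirlim_class \<phi> n (f x y)"
    proof
      fix w assume "w \<in> dirlim_rel \<phi> `` ?S"
      then obtain v where v: "v \<in> ?S" "(v, w) \<in> dirlim_rel \<phi>"
        by (rule ImageE)
      have "((n, f x y), v) \<in> dirlim_rel \<phi>"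
        using sub v(1) by (auto simp: dirlim_class_def)
      hence "((n, f x y), w) \<in> dirlim_rel \<phi>"
        using v(2) equiv_dirlim_rel[of \<phi>] by (meson equivE transD)
      thus "w \<in> dirlim_class \<phi> n (f x y)"
        by (simp add: dirlim_class_def)
    qed
    have "(n, f x y) \<in> ?S"
      using self by blast
    thus "dirlim_class \<phi> n (f x y) \<subseteq> dirlim_rel \<phi> `` ?S"
      by (auto simp: dirlim_class_def)
  qed
qed

lemma dirlim_mult:
  assumes "\<And>n x y. \<phi> n (x * y) = \<phi> n x * \<phi> n y"
  shows "dirlim_class \<phi> n x \<otimes>\<^bsub>dirlim \<phi>\<^esub> dirlim_class \<phi> n y = dirlim_class \<phi> n (x * y)"
  using dirlim_op[of \<phi> "(*)", OF assms] by (simp add: dirlim_def)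

lemma dirlim_add:
  assumes "\<And>n x y. \<phi> n (x + y) = \<phi> n x + \<phi> n y"
  shows "dirlim_class \<phi> n x \<oplus>\<^bsub>dirlim \<phi>\<^esub> dirlim_class \<phi> n y = dirlim_class \<phi> n (x + y)"
  using dirlim_op[of \<phi> "(+)", OF assms] by (simp add: dirlim_def)


section \<open>The ring $R(k,d)$\<close>

text \<open>
  The number \<open>d\<close> is the cardinality of the index type \<open>'d\<close>; its linear order is
  only needed for the library's proof that polynomial rings are integral domains. The sequences
  indexed by \<open>i \<ge> 1\<close> in the mathematical text are indexed by \<open>n = i - 1\<close>
  here: \<open>p n\<close> is $p_{n+1}$, \<open>alpha j n\<close> is $\alpha_{j,n+1}$, and stage
  \<open>n\<close> is $R_{n+1}$.

  \<open>('k, 'd) ratfun\<close> is the field of rational functions over \<open>'k\<close> in the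
  indeterminates \<open>alpha j n\<close>; \<open>('k, 'd) laurent\<close> is the Laurent polynomial
  ring over it, as the group algebra of the free abelian group on \<open>'d\<close>.
\<close>

type_synonym ('k, 'd) ratfun = "((('d \<times> nat) \<Rightarrow>\<^sub>0 nat) \<Rightarrow>\<^sub>0 'k) fract"

type_synonym ('k, 'd) laurent = "('d \<Rightarrow>\<^sub>0 int) \<Rightarrow>\<^sub>0 ('k, 'd) ratfun"

definition alpha :: "'d \<Rightarrow> nat \<Rightarrow> ('k::field_char_0, 'd::{finite,linorder}) ratfun" where
  "alpha j n = Fract (Poly_Mapping.single (Poly_Mapping.single (j, n) 1) 1) 1"

definition lconst :: "('k::field_char_0, 'd::{finite,linorder}) ratfun \<Rightarrow> ('k, 'd) laurent" where
  "lconst c = Poly_Mapping.single 0 c"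

definition tvar :: "'d \<Rightarrow> ('k::field_char_0, 'd::{finite,linorder}) laurent" where
  "tvar j = Poly_Mapping.single (Poly_Mapping.single j 1) 1"

text \<open>
  The homomorphism of \<open>('k, 'd) ratfun\<close>-algebras with
  \<open>tvar j \<mapsto> (alpha j (n + 1))\<inverse> (tvar j) ^ (p n)\<close>, written out on
  monomials; see \<open>phi_add\<close>, \<open>phi_mult\<close>, \<open>phi_lconst\<close>,
  \<open>phi_tvar\<close>.
\<close>

definition phi :: "(nat \<Rightarrow> nat) \<Rightarrow> nat \<Rightarrow>
    ('k::field_char_0, 'd::{finite,linorder}) laurent \<Rightarrow> ('k, 'd) laurent" where
  "phi p n f = (\<Sum>e\<in>Poly_Mapping.keys f.
     Poly_Mapping.single (Poly_Mapping.map (\<lambda>a. int (p n) * a) e)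
       (Poly_Mapping.lookup f e * (\<Prod>j\<in>UNIV. alpha j (Suc n) powi (- Poly_Mapping.lookup e j))))"

definition R_kd :: "(nat \<Rightarrow> nat) \<Rightarrow>
    (nat \<times> ('k::field_char_0, 'd::{finite,linorder}) laurent) set ring" where
  "R_kd p = dirlim (phi p)"

definition monomial_degree :: "(nat \<Rightarrow> nat) \<Rightarrow> nat \<Rightarrow> ('d::finite \<Rightarrow>\<^sub>0 int) \<Rightarrow> rat^'d" where
  "monomial_degree p n e = (\<chi> j. of_int (Poly_Mapping.lookup e j) / of_nat (\<Prod>m<n. p m))"

definition stage_component :: "(nat \<Rightarrow> nat) \<Rightarrow> nat \<Rightarrow> rat^('d::{finite,linorder}) \<Rightarrow>
    ('k::field_char_0, 'd::{finite,linorder}) laurent set" where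
  "stage_component p n g = {f. \<forall>e\<in>Poly_Mapping.keys f. monomial_degree p n e = g}"

definition R_kd_component :: "(nat \<Rightarrow> nat) \<Rightarrow> rat^('d::{finite,linorder}) \<Rightarrow>
    (nat \<times> ('k::field_char_0, 'd::{finite,linorder}) laurent) set set" where
  "R_kd_component p g = {dirlim_class (phi p) n f | n f. f \<in> stage_component p n g}"

lemma alpha_nonzero:
  "(alpha j n :: ('k::field_char_0, 'd::{finite,linorder}) ratfun) \<noteq> 0"
proof -
  have "Poly_Mapping.single m (1 :: 'k) \<noteq> 0" for m :: "('d \<times> nat) \<Rightarrow>\<^sub>0 nat"
    by (metis lookup_single_eq lookup_zero zero_neq_one)
  thus ?thesis
    by (simp add: alpha_def Zero_fract_def eq_fract)
qed

lemma lookup_scale: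
  "Poly_Mapping.lookup (Poly_Mapping.map (\<lambda>a. c * a) e) j = c * Poly_Mapping.lookup e j"
  for c :: int
  by (simp add: Poly_Mapping.map.rep_eq when_def)

lemma phi_superset:
  assumes "finite E" "Poly_Mapping.keys f \<subseteq> E"
  shows "phi p n f = (\<Sum>e\<in>E. Poly_Mapping.single (Poly_Mapping.map (\<lambda>a. int (p n) * a) e)
     (Poly_Mapping.lookup f e * (\<Prod>j\<in>UNIV. alpha j (Suc n) powi (- Poly_Mapping.lookup e j))))"
  unfolding phi_def using assms
  by (intro sum.mono_neutral_left) (auto simp: in_keys_iff)

lemma phi_single:
  "phi p n (Poly_Mapping.single e c) = Poly_Mapping.single (Poly_Mapping.map (\<lambda>a. int (p n) * a) e)
     (c * (\<Prod>j\<in>UNIV. alpha j (Suc n) powi (- Poly_Mapping.lookup e j)))"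
  by (subst phi_superset[of "{e}"]) auto

lemma phi_add: "phi p n (f + g) = phi p n f + phi p n g"
proof -
  let ?E = "Poly_Mapping.keys f \<union> Poly_Mapping.keys g"
  have "Poly_Mapping.keys (f + g) \<subseteq> ?E"
    by (rule Poly_Mapping.keys_add)
  thus ?thesis
    by (simp add: phi_superset[of ?E] lookup_add distrib_right single_add sum.distrib)
qed

lemma phi_zero: "phi p n 0 = 0"
  by (simp add: phi_def)

lemma poly_mapping_add_induct [case_names zero single add]:
  assumes "P 0" "\<And>a b. P (Poly_Mapping.single a b)" "\<And>f g. P f \<Longrightarrow> P g \<Longrightarrow> P (f + g)"
  shows "P (f :: 'a \<Rightarrow>\<^sub>0 'b::comm_monoid_add)"
proof (induction f rule: update_induct)
  case (update f a b)
  have "Poly_Mapping.update a b f = Poly_Mapping.single a b + f"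
    using update(1)
    by (intro poly_mapping_eqI) (auto simp: lookup_add lookup_update lookup_single when_def in_keys_iff)
  with update assms show ?case
    by metis
qed (fact assms(1))

lemma phi_mult:
  fixes f g :: "('k::field_char_0, 'd::{finite,linorder}) laurent"
  shows "phi p n (f * g) = phi p n f * phi p n g"
proof -
  have map_add: "Poly_Mapping.map (\<lambda>a. int (p n) * a) (d + e) =
      Poly_Mapping.map (\<lambda>a. int (p n) * a) d + Poly_Mapping.map (\<lambda>a. int (p n) * a) e"
    for d e :: "'d \<Rightarrow>\<^sub>0 int"
    by (rule poly_mapping_eqI) (simp only: lookup_add lookup_scale distrib_left)
  have alpha_add: "(alpha j (Suc n) :: ('k, 'd) ratfun) powi (- (a + b)) =
      alpha j (Suc n) powi (- a) * alpha j (Suc n) powi (- b)" for j :: 'd and a b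
    using power_int_add[of "alpha j (Suc n)" "- a" "- b"] by (simp add: alpha_nonzero)
  have mono: "phi p n (Poly_Mapping.single d a * Poly_Mapping.single e b) =
      phi p n (Poly_Mapping.single d a) * phi p n (Poly_Mapping.single e b)"
    for d e :: "'d \<Rightarrow>\<^sub>0 int" and a b :: "('k, 'd) ratfun"
    by (simp only: mult_single phi_single map_add lookup_add alpha_add prod.distrib mult.assoc mult.left_commute)
  have right: "phi p n (Poly_Mapping.single d a * g) = phi p n (Poly_Mapping.single d a) * phi p n g"
    for d :: "'d \<Rightarrow>\<^sub>0 int" and a :: "('k, 'd) ratfun" and g
    by (induction g rule: poly_mapping_add_induct) (simp_all only: mono distrib_left phi_add phi_zero mult_zero_right)
  show ?thesis
    by (induction f rule: poly_mapping_add_induct) (simp_all only: right distrib_right phi_add phi_zero mult_zero_left)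
qed

lemma phi_lconst:
  fixes c :: "('k::field_char_0, 'd::{finite,linorder}) ratfun"
  shows "phi p n (lconst c) = lconst c"
proof -
  have "Poly_Mapping.map (\<lambda>a. int (p n) * a) (0 :: 'd \<Rightarrow>\<^sub>0 int) = 0"
    by (rule poly_mapping_eqI) (simp add: lookup_scale)
  thus ?thesis
    by (simp add: lconst_def phi_single)
qed

lemma phi_tvar:
  fixes j :: "'d::{finite,linorder}"
  shows "phi p n (tvar j :: ('k::field_char_0, 'd) laurent) =
    lconst (inverse (alpha j (Suc n))) * tvar j ^ p n"
proof -
  have pow: "(tvar j :: ('k, 'd) laurent) ^ m = Poly_Mapping.single (Poly_Mapping.single j (int m)) 1" for m
    by (induction m) (simp_all add: tvar_def mult_single flip: single_add)
  have "(\<Prod>i\<in>UNIV. (alpha i (Suc n) :: ('k, 'd) ratfun) powi (- (if i = j then 1 else 0))) =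
        (\<Prod>i\<in>UNIV. if i = j then inverse (alpha j (Suc n)) else 1)"
    by (rule prod.cong) (auto simp: power_int_minus)
  also have "\<dots> = inverse (alpha j (Suc n))"
    by simp
  finally show ?thesis
    unfolding pow
    by (simp add: tvar_def lconst_def phi_single mult_single lookup_single when_def eq_commute[of j])
qed

lemma tvar_degree:
  "tvar j \<in> stage_component p n ((1 / of_nat (\<Prod>m<n. p m)) *s axis j 1)"
  by (auto simp: stage_component_def tvar_def monomial_degree_def vec_eq_iff axis_def
      lookup_single when_def)

lemma phi_stage_component:
  assumes "p n \<noteq> 0" "f \<in> stage_component p n g"
  shows "phi p n f \<in> stage_component p (Suc n) g"
proof -
  have deg: "monomial_degree p (Suc n) (Poly_Mapping.map (\<lambda>a. int (p n) * a) e) =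
      monomial_degree p n e" for e :: "'a \<Rightarrow>\<^sub>0 int"
    using assms(1) by (auto simp: monomial_degree_def vec_eq_iff lookup_scale)
  have "Poly_Mapping.keys (phi p n f) \<subseteq>
      (\<Union>e\<in>Poly_Mapping.keys f. {Poly_Mapping.map (\<lambda>a. int (p n) * a) e})"
    unfolding phi_def by (rule order.trans[OF Poly_Mapping.keys_sum]) (auto split: if_splits)
  thus ?thesis
    using assms(2) deg by (fastforce simp: stage_component_def)
qed

end

theory Submission
  imports Defs
begin

text \<open>
  A nonzero homogeneous element of \<open>R\<close> is a single Laurent monomial, hence a unit; so
  \<open>R\<close> is a graded field. For the Noetherian property, write $s_{j,i}$ for the inverse of
  $t_{j,i}$. The relation $s_{j,i} = \alpha_{j,i+1} s_{j,i+1}^{p_i}$ allows us to eliminate the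
  $\alpha_{j,i}$ for $i > 1$, so \<open>R\<close> is a localization of the polynomial ring \<open>T\<close>
  over \<open>k\<close> in the variables $\alpha_{j,1}$ and $s_{j,i}$, and so is every $R_i$, with the
  $\alpha_{j,m}$ for $m > i$ taking the place of the missing variables.

  By Cohen's theorem it suffices to show that a prime ideal \<open>P\<close> of \<open>R\<close> is finitely
  generated. By Hilbert's basis theorem $P \cap R_1$ has finitely many generators; these are
  fractions of polynomials in the variables of \<open>T\<close> that occur at stages up to some
  \<open>M\<close>. Let \<open>Q\<close> be the ideal of \<open>R\<close> generated by the polynomials of
  \<open>P\<close> in these variables. It is prime, because primes extend to primes along polynomial
  extensions and localizations; it is finitely generated, because its generators lie in the
  Noetherian ring $R_M$; and it has the same contraction to $R_1$ as \<open>P\<close>. Each $R_{i+1}$ is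
  a finite $R_i$-module, so incomparability turns $Q \subseteq P$ into $Q = P$.
\<close>

section \<open>Ideals\<close>

text \<open>If all \<alpha> were 1, the limit would be the group algebra of Q^d over K, which is not
  Noetherian: the prime generated at every stage by the t_j - 1 needs new generators each time,
  because t_i - 1 = t_{i+1}^p - 1 has further factors. The independent coefficients \<alpha> have to
  stop such splitting. Finitely many generators of P \<inter> R_1 involve only finitely many of
  them, and each later step takes roots of monomials with fresh coefficients.

  The coordinates of T make this visible. From one stage to the next the fresh \<alpha> is traded
  for the new s, polynomials in the older variables keep their meaning, and the other variables stay
  free. That a prime does not split further thus becomes the statement that q[X] is prime if q is,
  which requires no knowledge of P beyond R_1. Finiteness of the transition maps enters only
  afterwards, to see that the extended prime is all of P.\<close>

definition ideal_on :: "'a::comm_ring_1 set \<Rightarrow> 'a set \<Rightarrow> bool" where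
  "ideal_on A I \<longleftrightarrow> I \<subseteq> A \<and> 0 \<in> I \<and> (\<forall>x\<in>I. \<forall>y\<in>I. x + y \<in> I) \<and> (\<forall>a\<in>A. \<forall>x\<in>I. a * x \<in> I)"

definition subring_on :: "'a::comm_ring_1 set \<Rightarrow> bool" where
  "subring_on A \<longleftrightarrow> 1 \<in> A \<and> (\<forall>x\<in>A. - x \<in> A) \<and> (\<forall>x\<in>A. \<forall>y\<in>A. x + y \<in> A \<and> x * y \<in> A)"

text \<open>Rings are subsets of one type, so that adjoining elements one at a time stays inside the
  type of Laurent polynomials.\<close>

definition noetherian_on :: "'a::comm_ring_1 set \<Rightarrow> bool" where
  "noetherian_on A \<longleftrightarrow>
     (\<forall>I. ideal_on A I \<longrightarrow> (\<exists>F. finite F \<and> F \<subseteq> I \<and> I \<subseteq> ideal_on A hull F))"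

definition prime_on :: "'a::comm_ring_1 set \<Rightarrow> bool" where
  "prime_on P \<longleftrightarrow> ideal_on UNIV P \<and> 1 \<notin> P \<and> (\<forall>x y. x * y \<in> P \<longrightarrow> x \<in> P \<or> y \<in> P)"

lemma ideal_onD:
  assumes "ideal_on A I"
  shows "I \<subseteq> A" "0 \<in> I" "x \<in> I \<Longrightarrow> y \<in> I \<Longrightarrow> x + y \<in> I"
    "a \<in> A \<Longrightarrow> x \<in> I \<Longrightarrow> a * x \<in> I" "a \<in> A \<Longrightarrow> x \<in> I \<Longrightarrow> x * a \<in> I"
  using assms by (auto simp: ideal_on_def mult.commute)

lemma subring_onD:
  assumes "subring_on A"
  shows "1 \<in> A" "0 \<in> A" "x \<in> A \<Longrightarrow> - x \<in> A" "x \<in> A \<Longrightarrow> y \<in> A \<Longrightarrow> x + y \<in> A"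
    "x \<in> A \<Longrightarrow> y \<in> A \<Longrightarrow> x * y \<in> A"
proof -
  show "1 \<in> A" "x \<in> A \<Longrightarrow> - x \<in> A" "x \<in> A \<Longrightarrow> y \<in> A \<Longrightarrow> x + y \<in> A" "x \<in> A \<Longrightarrow> y \<in> A \<Longrightarrow> x * y \<in> A"
    using assms by (auto simp: subring_on_def)
  have "1 + - 1 \<in> A"
    using assms unfolding subring_on_def by blast
  thus "0 \<in> A" by simp
qed

lemma subring_on_UNIV: "subring_on UNIV"
  by (simp add: subring_on_def)

lemma ideal_on_diff:
  assumes "subring_on A" "ideal_on A I" "x \<in> I" "y \<in> I"
  shows "x - y \<in> I"
proof -
  have "(- 1) * y \<in> I"
    using assms by (intro ideal_onD(4)) (auto intro: subring_onD)
  from ideal_onD(3)[OF assms(2,3) this] show ?thesis by simp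
qed

lemma ideal_on_UNIV_diff: "ideal_on UNIV I \<Longrightarrow> x \<in> I \<Longrightarrow> y \<in> I \<Longrightarrow> x - y \<in> I"
  using ideal_on_diff[OF subring_on_UNIV] .

lemma ideal_on_sum:
  assumes "ideal_on A I" "\<And>x. x \<in> S \<Longrightarrow> f x \<in> I"
  shows "sum f S \<in> I"
  using assms(2) by (induction S rule: infinite_finite_induct) (auto intro: ideal_onD[OF assms(1)])

lemma ideal_on_hull:
  assumes "subring_on A" "F \<subseteq> A"
  shows "ideal_on A (ideal_on A hull F)"
proof -
  have "ideal_on A A"
    using subring_onD[OF assms(1)] by (simp add: ideal_on_def)
  hence "ideal_on A hull F \<subseteq> A"
    using assms(2) by (simp add: hull_minimal)
  thus ?thesis
    unfolding ideal_on_def hull_def by blast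
qed

lemma ideal_on_UNIV_hull: "ideal_on UNIV (ideal_on UNIV hull F)"
  by (simp add: ideal_on_hull subring_on_UNIV)

lemma ideal_on_vimage:
  assumes add: "\<And>x y. h (x + y) = h x + h y" and mult: "\<And>x y. h (x * y) = h x * h y"
    and "ideal_on UNIV I"
  shows "ideal_on UNIV (h -` I)"
proof -
  have "h 0 = 0"
    using add[of 0 0] by simp
  with ideal_onD[OF assms(3)] show ?thesis
    by (auto simp: ideal_on_def add mult)
qed

lemma prime_onD:
  assumes "prime_on P"
  shows "ideal_on UNIV P" "1 \<notin> P" "x * y \<in> P \<Longrightarrow> x \<in> P \<or> y \<in> P"
  using assms by (auto simp: prime_on_def)

lemma prime_on_not_unit:
  assumes "prime_on P" "u dvd 1"
  shows "u \<notin> P"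
  using ideal_onD(5)[OF prime_onD(1)[OF assms(1)]] prime_onD(2)[OF assms(1)] assms(2)
  by (metis UNIV_I dvdE)

lemma prime_on_vimage:
  assumes add: "\<And>x y. h (x + y) = h x + h y" and mult: "\<And>x y. h (x * y) = h x * h y"
    and one: "h 1 = 1" and P: "prime_on P"
  shows "prime_on (h -` P)"
  unfolding prime_on_def
  using ideal_on_vimage[of h P, OF add mult prime_onD(1)[OF P]] prime_onD(2,3)[OF P]
  by (auto simp: mult one)

section \<open>Hilbert's basis theorem\<close>

text \<open>The subring A[x] of the ambient ring. Since \<open>x\<close> may satisfy algebraic
  relations over \<open>A\<close>, its elements are handled through chosen representing
  polynomials.\<close>

definition adjoin :: "'a::comm_ring_1 set \<Rightarrow> 'a \<Rightarrow> 'a set" where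
  "adjoin A x = {poly f x | f. \<forall>i. coeff f i \<in> A}"

lemma adjoin_subset: "subring_on A \<Longrightarrow> A \<subseteq> adjoin A x"
proof
  fix a assume "subring_on A" "a \<in> A"
  hence "\<forall>i. coeff [:a:] i \<in> A"
    by (auto simp: coeff_pCons subring_onD split: nat.split)
  thus "a \<in> adjoin A x"
    unfolding adjoin_def by (intro CollectI exI[of _ "[:a:]"]) simp
qed

lemma adjoin_self: "subring_on A \<Longrightarrow> x \<in> adjoin A x"
  unfolding adjoin_def
  by (intro CollectI exI[of _ "[:0, 1:]"]) (auto simp: coeff_pCons subring_onD split: nat.split)

lemma subring_on_sum:
  assumes "subring_on A" "\<And>x. x \<in> S \<Longrightarrow> f x \<in> A"
  shows "sum f S \<in> A"
  using assms(2) by (induction S rule: infinite_finite_induct) (auto intro: subring_onD[OF assms(1)])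

lemma subring_on_adjoin:
  assumes A: "subring_on A"
  shows "subring_on (adjoin A x)"
  unfolding subring_on_def
proof (intro conjI ballI)
  show "1 \<in> adjoin A x"
    using adjoin_subset[OF A] subring_onD(1)[OF A] by blast
next
  fix y assume "y \<in> adjoin A x"
  then obtain f where f: "y = poly f x" "\<forall>i. coeff f i \<in> A"
    by (auto simp: adjoin_def)
  thus "- y \<in> adjoin A x"
    unfolding adjoin_def by (intro CollectI exI[of _ "- f"]) (auto intro: subring_onD[OF A])
next
  fix y z assume "y \<in> adjoin A x" "z \<in> adjoin A x"
  then obtain f g where f: "y = poly f x" "\<forall>i. coeff f i \<in> A" and g: "z = poly g x" "\<forall>i. coeff g i \<in> A"
    by (auto simp: adjoin_def)
  show "y + z \<in> adjoin A x"
    unfolding adjoin_def using f g by (intro CollectI exI[of _ "f + g"]) (auto intro: subring_onD[OF A])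
  show "y * z \<in> adjoin A x"
    unfolding adjoin_def using f g
    by (intro CollectI exI[of _ "f * g"]) (auto simp: coeff_mult intro!: subring_on_sum[OF A] subring_onD(5)[OF A])
qed

text \<open>Bounding the degree by \<open>n\<close> instead of fixing it keeps 0, and sums whose top
  terms cancel, in the set; this makes it an ideal.\<close>

definition leading_coeffs :: "'a::comm_ring_1 set \<Rightarrow> 'a \<Rightarrow> 'a set \<Rightarrow> nat \<Rightarrow> 'a set" where
  "leading_coeffs A x I n =
     {coeff f n | f. (\<forall>i. coeff f i \<in> A) \<and> (\<forall>i>n. coeff f i = 0) \<and> poly f x \<in> I}"

lemma leading_coeffs_ideal:
  assumes A: "subring_on A" and I: "ideal_on (adjoin A x) I"
  shows "ideal_on A (leading_coeffs A x I n)"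
  unfolding ideal_on_def
proof (intro conjI ballI)
  show "leading_coeffs A x I n \<subseteq> A"
    by (auto simp: leading_coeffs_def)
  show "0 \<in> leading_coeffs A x I n"
    unfolding leading_coeffs_def using subring_onD(2)[OF A] ideal_onD(2)[OF I]
    by (intro CollectI exI[of _ 0]) auto
next
  fix a b assume "a \<in> leading_coeffs A x I n" "b \<in> leading_coeffs A x I n"
  then obtain f g where "a = coeff f n" "b = coeff g n" "\<forall>i. coeff f i \<in> A" "\<forall>i. coeff g i \<in> A"
    "\<forall>i>n. coeff f i = 0" "\<forall>i>n. coeff g i = 0" "poly f x \<in> I" "poly g x \<in> I"
    by (auto simp: leading_coeffs_def)
  thus "a + b \<in> leading_coeffs A x I n"
    unfolding leading_coeffs_def using subring_onD(4)[OF A] ideal_onD(3)[OF I]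
    by (intro CollectI exI[of _ "f + g"]) auto
next
  fix c a assume c: "c \<in> A" and "a \<in> leading_coeffs A x I n"
  then obtain f where "a = coeff f n" "\<forall>i. coeff f i \<in> A" "\<forall>i>n. coeff f i = 0" "poly f x \<in> I"
    by (auto simp: leading_coeffs_def)
  thus "c * a \<in> leading_coeffs A x I n"
    unfolding leading_coeffs_def using subring_onD(5)[OF A] ideal_onD(4)[OF I subsetD[OF adjoin_subset[OF A] c]] c
    by (intro CollectI exI[of _ "smult c f"]) auto
qed

text \<open>Multiplying the representing polynomial by the indeterminate moves its coefficients up
  one place and multiplies its value by \<open>x\<close>, which stays in \<open>I\<close>.\<close>

lemma leading_coeffs_mono:
  assumes A: "subring_on A" and I: "ideal_on (adjoin A x) I" and "m \<le> n"
  shows "leading_coeffs A x I m \<subseteq> leading_coeffs A x I n"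
  using \<open>m \<le> n\<close>
proof (induction rule: dec_induct)
  case (step n)
  have "leading_coeffs A x I n \<subseteq> leading_coeffs A x I (Suc n)"
  proof
    fix a assume "a \<in> leading_coeffs A x I n"
    then obtain f where f: "a = coeff f n" "\<forall>i. coeff f i \<in> A" "\<forall>i>n. coeff f i = 0" "poly f x \<in> I"
      by (auto simp: leading_coeffs_def)
    have "poly (pCons 0 f) x \<in> I"
      using ideal_onD(4)[OF I adjoin_self[OF A] f(4)] by simp
    with f show "a \<in> leading_coeffs A x I (Suc n)"
      unfolding leading_coeffs_def using subring_onD(2)[OF A]
      by (intro CollectI exI[of _ "pCons 0 f"]) (auto simp: coeff_pCons split: nat.split)
  qed
  with step show ?case by blast
qed auto

text \<open>The ideals of leading coefficients increase with the degree. Their union is finitely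
  generated, so they are constant from some \<open>N\<close> on, and each degree up to
  \<open>N\<close> contributes finitely many generators.\<close>

theorem hilbert_basis:
  assumes A: "subring_on A" and noeth: "noetherian_on A"
  shows "noetherian_on (adjoin A x)"
  unfolding noetherian_on_def
proof (intro allI impI)
  fix I assume I: "ideal_on (adjoin A x) I"
  let ?L = "leading_coeffs A x I"
  note B = subring_on_adjoin[OF A, of x]
  have gens: "\<exists>F. finite F \<and> F \<subseteq> K \<and> K \<subseteq> ideal_on A hull F" if "ideal_on A K" for K
    using noeth that by (auto simp: noetherian_on_def)
  have "ideal_on A (\<Union>n. ?L n)"
    unfolding ideal_on_def
  proof (intro conjI ballI)
    show "(\<Union>n. ?L n) \<subseteq> A" "0 \<in> (\<Union>n. ?L n)"
      using ideal_onD(1,2)[OF leading_coeffs_ideal[OF A I]] by blast+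
    show "a + b \<in> (\<Union>n. ?L n)" if ab: "a \<in> (\<Union>n. ?L n)" "b \<in> (\<Union>n. ?L n)" for a b
    proof -
      obtain m n where "a \<in> ?L m" "b \<in> ?L n" using ab by blast
      hence "a \<in> ?L (max m n)" "b \<in> ?L (max m n)"
        using leading_coeffs_mono[OF A I] by (meson max.cobounded1 max.cobounded2 subsetD)+
      thus ?thesis
        using ideal_onD(3)[OF leading_coeffs_ideal[OF A I]] by blast
    qed
    show "c * a \<in> (\<Union>n. ?L n)" if "c \<in> A" "a \<in> (\<Union>n. ?L n)" for c a
      using that ideal_onD(4)[OF leading_coeffs_ideal[OF A I]] by blast
  qed
  then obtain F where F: "finite F" "F \<subseteq> (\<Union>n. ?L n)" "(\<Union>n. ?L n) \<subseteq> ideal_on A hull F"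
    using gens by blast
  obtain N where N: "F \<subseteq> ?L N"
  proof -
    have "\<exists>N. F \<subseteq> ?L N"
      using F(1,2)
    proof (induction F)
      case (insert a F)
      then obtain m n where "a \<in> ?L m" "F \<subseteq> ?L n" by auto
      hence "insert a F \<subseteq> ?L (max m n)"
        using leading_coeffs_mono[OF A I] by (meson insert_subset max.cobounded1 max.cobounded2 subset_trans subsetD)
      thus ?case by blast
    qed auto
    thus ?thesis using that by blast
  qed
  have "\<forall>n. \<exists>G. finite G \<and> G \<subseteq> ?L n \<and> ?L n \<subseteq> ideal_on A hull G"
    using gens leading_coeffs_ideal[OF A I] by blast
  then obtain G where G: "\<And>n. finite (G n)" "\<And>n. G n \<subseteq> ?L n" "\<And>n. ?L n \<subseteq> ideal_on A hull (G n)"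
    by metis
  have "\<forall>n. \<forall>a\<in>?L n. \<exists>f. a = coeff f n \<and> (\<forall>i. coeff f i \<in> A) \<and> (\<forall>i>n. coeff f i = 0) \<and> poly f x \<in> I"
    by (auto simp: leading_coeffs_def)
  then obtain q where q: "\<And>n a. a \<in> ?L n \<Longrightarrow> a = coeff (q n a) n \<and> (\<forall>i. coeff (q n a) i \<in> A) \<and>
      (\<forall>i>n. coeff (q n a) i = 0) \<and> poly (q n a) x \<in> I"
    by metis
  define H where "H = (\<Union>n\<le>N. (\<lambda>a. poly (q n a) x) ` G n) \<union> (\<lambda>a. poly (q N a) x) ` F"
  have "finite H"
    using F(1) G(1) by (auto simp: H_def)
  have HI: "H \<subseteq> I"
    using q G(2) N by (fastforce simp: H_def)
  let ?H = "ideal_on (adjoin A x) hull H"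
  have hull: "ideal_on (adjoin A x) ?H"
    using ideal_on_hull[OF B] HI ideal_onD(1)[OF I] by blast
  have hull_sub: "?H \<subseteq> I"
    using HI I by (rule hull_minimal)
  \<comment> \<open>The ideal spanned by \<open>H\<close> has all the leading coefficients of
    \<open>I\<close>: up to \<open>N\<close> because of \<open>G n\<close>, beyond \<open>N\<close>
    because those of \<open>F\<close> can be shifted upwards.\<close>
  have lead: "?L n \<subseteq> leading_coeffs A x ?H n" for n
  proof (cases "n \<le> N")
    case True
    have "G n \<subseteq> leading_coeffs A x ?H n"
    proof
      fix a assume a: "a \<in> G n"
      have "poly (q n a) x \<in> ?H"
        by (rule hull_inc) (use a True in \<open>auto simp: H_def\<close>)
      with q[of a n] a G(2)[of n] show "a \<in> leading_coeffs A x ?H n"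
        unfolding leading_coeffs_def by (intro CollectI exI[of _ "q n a"]) auto
    qed
    hence "ideal_on A hull (G n) \<subseteq> leading_coeffs A x ?H n"
      using leading_coeffs_ideal[OF A hull] by (rule hull_minimal)
    with G(3) show ?thesis by blast
  next
    case False
    have "F \<subseteq> leading_coeffs A x ?H N"
    proof
      fix a assume a: "a \<in> F"
      have "poly (q N a) x \<in> ?H"
        by (rule hull_inc) (use a in \<open>auto simp: H_def\<close>)
      with q[of a N] a N show "a \<in> leading_coeffs A x ?H N"
        unfolding leading_coeffs_def by (intro CollectI exI[of _ "q N a"]) auto
    qed
    also have "\<dots> \<subseteq> leading_coeffs A x ?H n"
      using False by (intro leading_coeffs_mono[OF A hull]) auto
    finally have "ideal_on A hull F \<subseteq> leading_coeffs A x ?H n"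
      using leading_coeffs_ideal[OF A hull] by (rule hull_minimal)
    with F(3) show ?thesis by blast
  qed
  \<comment> \<open>Induction on a strict degree bound: by \<open>lead\<close> some polynomial with
    value in \<open>?H\<close> has the same top coefficient, and subtracting it lowers the
    bound.\<close>
  have "poly f x \<in> ?H" if "\<forall>i\<ge>n. coeff f i = 0" "\<forall>i. coeff f i \<in> A" "poly f x \<in> I" for f n
    using that
  proof (induction n arbitrary: f)
    case 0
    hence "f = 0" by (auto intro: poly_eqI)
    thus ?case using ideal_onD(2)[OF hull] by simp
  next
    case (Suc n)
    have "coeff f n \<in> ?L n"
      unfolding leading_coeffs_def using Suc.prems by (intro CollectI exI[of _ f]) auto
    hence "coeff f n \<in> leading_coeffs A x ?H n"
      using lead by blast
    then obtain g where g: "coeff f n = coeff g n" "\<forall>i. coeff g i \<in> A" "\<forall>i>n. coeff g i = 0" "poly g x \<in> ?H"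
      by (auto simp: leading_coeffs_def)
    have "coeff (f - g) i = 0" if "i \<ge> n" for i
      using that g(1,3) Suc.prems(1) by (cases "i = n") auto
    moreover have "coeff (f - g) i \<in> A" for i
      using subring_onD(4)[OF A, of "coeff f i" "- coeff g i"] subring_onD(3)[OF A] g(2) Suc.prems(2) by auto
    moreover have "poly (f - g) x \<in> I"
      using ideal_on_diff[OF B I Suc.prems(3), of "poly g x"] g(4) hull_sub by auto
    ultimately have "poly (f - g) x \<in> ?H"
      using Suc.IH by blast
    from ideal_onD(3)[OF hull this g(4)] show ?case by simp
  qed
  note reduce = this
  have "I \<subseteq> ?H"
  proof
    fix y assume y: "y \<in> I"
    then obtain f where f: "y = poly f x" "\<forall>i. coeff f i \<in> A"
      using ideal_onD(1)[OF I] by (auto simp: adjoin_def)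
    have "\<forall>i\<ge>Suc (degree f). coeff f i = 0"
      by (simp add: coeff_eq_0)
    from reduce[OF this f(2)] y f(1) show "y \<in> ?H" by simp
  qed
  with \<open>finite H\<close> HI show "\<exists>F. finite F \<and> F \<subseteq> I \<and> I \<subseteq> ideal_on (adjoin A x) hull F"
    by blast
qed

lemma noetherian_on_adjoin_finite:
  assumes "finite Y" "subring_on A" "noetherian_on A"
  obtains B where "subring_on B" "noetherian_on B" "A \<subseteq> B" "Y \<subseteq> B"
proof -
  have "\<exists>B. subring_on B \<and> noetherian_on B \<and> A \<subseteq> B \<and> Y \<subseteq> B"
    using assms(1)
  proof (induction Y)
    case empty
    with assms(2,3) show ?case by blast
  next
    case (insert x Y)
    then obtain B where "subring_on B" "noetherian_on B" "A \<subseteq> B" "Y \<subseteq> B" by blast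
    hence "subring_on (adjoin B x) \<and> noetherian_on (adjoin B x) \<and> A \<subseteq> adjoin B x \<and> insert x Y \<subseteq> adjoin B x"
      using subring_on_adjoin hilbert_basis adjoin_subset[of B x] adjoin_self[of B x] by blast
    thus ?case by blast
  qed
  thus ?thesis using that by blast
qed

section \<open>Incomparability\<close>

text \<open>Over the fraction field of the ring modulo \<open>q\<close> this is a homogeneous system
  with more unknowns than equations. Gaussian elimination with cross multiplication finds a nonzero
  solution without leaving the ring.\<close>

lemma linear_system_mod_prime:
  assumes q: "prime_on q" and "finite S" "finite J" "card S < card J"
  shows "\<exists>c. (\<exists>j\<in>J. c j \<notin> q) \<and> (\<forall>s\<in>S. (\<Sum>j\<in>J. a s j * c j) \<in> q)"
  using assms(2-)
proof (induction S arbitrary: J a rule: finite_induct)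
  case empty
  then obtain j where "j \<in> J" by fastforce
  thus ?case
    using prime_onD(2)[OF q] by (intro exI[of _ "\<lambda>_. 1"]) auto
next
  case (insert s S)
  note qI = prime_onD(1)[OF q]
  show ?case
  proof (cases "\<forall>j\<in>J. a s j \<in> q")
    case True
    obtain c where "\<exists>j\<in>J. c j \<notin> q" "\<forall>s\<in>S. (\<Sum>j\<in>J. a s j * c j) \<in> q"
      using insert.IH[of J a] insert.prems insert.hyps by auto
    moreover have "(\<Sum>j\<in>J. a s j * c j) \<in> q"
      using True by (intro ideal_on_sum[OF qI]) (auto intro: ideal_onD[OF qI])
    ultimately show ?thesis by blast
  next
    case False
    then obtain k where k: "k \<in> J" "a s k \<notin> q" by blast
    \<comment> \<open>Row \<open>r\<close> with unknown \<open>k\<close> eliminated by the pivot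
      \<open>a s k\<close>, without division.\<close>
    define b where "b r j = a s k * a r j - a r k * a s j" for r j
    obtain c where c: "\<exists>j\<in>J - {k}. c j \<notin> q" "\<forall>r\<in>S. (\<Sum>j\<in>J - {k}. b r j * c j) \<in> q"
      using insert.IH[of "J - {k}" b] insert.prems insert.hyps k(1) by (auto simp: less_diff_conv)
    \<comment> \<open>The other unknowns are scaled by the pivot so that row \<open>s\<close> can be
      solved for unknown \<open>k\<close>. As the pivot lies outside the prime \<open>q\<close>, an
      entry outside \<open>q\<close> remains outside.\<close>
    define c' where "c' j = (if j = k then - (\<Sum>j\<in>J - {k}. a s j * c j) else a s k * c j)" for j
    have split: "(\<Sum>j\<in>J. a r j * c' j) =
        (\<Sum>j\<in>J - {k}. a r j * (a s k * c j)) - a r k * (\<Sum>j\<in>J - {k}. a s j * c j)" for r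
      using k(1) insert.prems(1) by (simp add: sum.remove[of J k] c'_def)
    have "(\<Sum>j\<in>J. a s j * c' j) \<in> q"
      unfolding split using ideal_onD(2)[OF qI] by (simp add: sum_distrib_left mult.left_commute)
    moreover have "(\<Sum>j\<in>J. a r j * c' j) = (\<Sum>j\<in>J - {k}. b r j * c j)" for r
      unfolding split by (simp add: b_def sum_distrib_left sum_subtractf[symmetric] algebra_simps)
    moreover have "\<exists>j\<in>J. c' j \<notin> q"
      using c(1) k(2) prime_onD(3)[OF q] by (auto simp: c'_def)
    ultimately show ?thesis
      using c(2) by (intro exI[of _ c']) auto
  qed
qed

text \<open>More powers of \<open>x\<close> than there are generators are linearly dependent modulo
  \<open>Q\<close>, with coefficients from the smaller ring. If \<open>x\<close> were in
  \<open>P\<close> but not in \<open>Q\<close>, the constant term of such a relation could be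
  removed again and again until every coefficient lies in \<open>Q\<close>.\<close>

theorem incomparability:
  fixes h :: "'a::comm_ring_1 \<Rightarrow> 'b::comm_ring_1"
  assumes add: "\<And>x y. h (x + y) = h x + h y" and mult: "\<And>x y. h (x * y) = h x * h y"
    and one: "h 1 = 1"
    and S: "finite S" and span: "\<And>x. \<exists>c. x = (\<Sum>s\<in>S. h (c s) * s)"
    and P: "prime_on P" and Q: "prime_on Q" and QP: "Q \<subseteq> P" and contr: "h -` P \<subseteq> h -` Q"
  shows "P = Q"
proof
  have q: "prime_on (h -` Q)"
    by (rule prime_on_vimage[OF add mult one Q])
  note PI = prime_onD(1)[OF P] and QI = prime_onD(1)[OF Q]
  have h_sum: "h (sum f I) = (\<Sum>i\<in>I. h (f i))" for f and I :: "'c set"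
  proof -
    have "h 0 = 0" using add[of 0 0] by simp
    thus ?thesis by (induction I rule: infinite_finite_induct) (auto simp: add)
  qed
  show "P \<subseteq> Q"
  proof
    fix x assume xP: "x \<in> P"
    \<comment> \<open>The constant coefficient lies in \<open>P\<close>, because \<open>x\<close>
      and the whole relation do, hence in \<open>Q\<close> by \<open>contr\<close>. What remains is
      \<open>x\<close> times a shorter relation, and \<open>Q\<close> is prime.\<close>
    have descent: "x \<in> Q" if "\<exists>i\<le>n. h (c i) \<notin> Q" "(\<Sum>i\<le>n. h (c i) * x ^ i) \<in> Q" for n c
      using that
    proof (induction n arbitrary: c)
      case 0
      hence "h (c 0) \<in> P" using QP by auto
      with 0 contr show ?case by auto
    next
      case (Suc n)
      have eq: "(\<Sum>i\<le>Suc n. h (c i) * x ^ i) = h (c 0) + x * (\<Sum>i\<le>n. h (c (Suc i)) * x ^ i)"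
        by (subst sum.atMost_Suc_shift) (simp add: sum_distrib_left algebra_simps)
      have "h (c 0) = (\<Sum>i\<le>Suc n. h (c i) * x ^ i) - x * (\<Sum>i\<le>n. h (c (Suc i)) * x ^ i)"
        unfolding eq by simp
      also have "\<dots> \<in> P"
        using Suc.prems(2) QP ideal_onD(5)[OF PI UNIV_I xP] by (intro ideal_on_UNIV_diff[OF PI]) auto
      finally have c0: "h (c 0) \<in> Q"
        using contr by auto
      have "x * (\<Sum>i\<le>n. h (c (Suc i)) * x ^ i) = (\<Sum>i\<le>Suc n. h (c i) * x ^ i) - h (c 0)"
        unfolding eq by simp
      also have "\<dots> \<in> Q"
        using Suc.prems(2) c0 by (intro ideal_on_UNIV_diff[OF QI])
      finally have "x \<in> Q \<or> (\<Sum>i\<le>n. h (c (Suc i)) * x ^ i) \<in> Q"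
        using prime_onD(3)[OF Q] by blast
      moreover have "\<exists>i\<le>n. h (c (Suc i)) \<notin> Q"
      proof -
        obtain i where "i \<le> Suc n" "h (c i) \<notin> Q" using Suc.prems(1) by blast
        with c0 show ?thesis by (cases i) auto
      qed
      ultimately show ?case
        using Suc.IH[of "\<lambda>i. c (Suc i)"] by blast
    qed
    have "\<forall>i. \<exists>c. x ^ i = (\<Sum>s\<in>S. h (c s) * s)"
      using span by blast
    then obtain a where a: "\<And>i. x ^ i = (\<Sum>s\<in>S. h (a i s) * s)"
      by metis
    \<comment> \<open>There are \<open>card S + 1\<close> powers of \<open>x\<close>, the unknowns,
      against \<open>card S\<close> generators, the equations.\<close>
    obtain c where c: "\<exists>j\<in>{..card S}. c j \<notin> h -` Q" "\<forall>s\<in>S. (\<Sum>j\<in>{..card S}. a j s * c j) \<in> h -` Q"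
      using linear_system_mod_prime[OF q S, of "{..card S}" "\<lambda>s j. a j s"] by auto
    have "(\<Sum>i\<le>card S. h (c i) * x ^ i) = (\<Sum>i\<le>card S. \<Sum>s\<in>S. h (a i s * c i) * s)"
      by (simp add: a sum_distrib_left mult algebra_simps)
    also have "\<dots> = (\<Sum>s\<in>S. h (\<Sum>i\<le>card S. a i s * c i) * s)"
      by (subst sum.swap) (simp add: h_sum sum_distrib_right)
    also have "\<dots> \<in> Q"
      using c(2) by (intro ideal_on_sum[OF QI] ideal_onD(5)[OF QI]) auto
    finally show "x \<in> Q"
      using c(1) descent by auto
  qed
qed fact

section \<open>Cohen's theorem\<close>

context cring
begin

lemma colon_ideal:
  assumes "ideal I R" "a \<in> carrier R"
  shows "ideal {r \<in> carrier R. r \<otimes> a \<in> I} R"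
proof -
  interpret I: ideal I R by fact
  show ?thesis
  proof (rule idealI)
    show "ring R" by (rule ring_axioms)
    show "subgroup {r \<in> carrier R. r \<otimes> a \<in> I} (add_monoid R)"
    proof (rule add.subgroupI)
      show "{r \<in> carrier R. r \<otimes> a \<in> I} \<noteq> {}"
        using assms(2) by (auto intro!: exI[of _ \<zero>])
    qed (use assms(2) in \<open>auto simp: l_minus l_distr I.a_inv_closed\<close>)
  next
    fix x r assume "x \<in> {r \<in> carrier R. r \<otimes> a \<in> I}" "r \<in> carrier R"
    thus "r \<otimes> x \<in> {r \<in> carrier R. r \<otimes> a \<in> I}" "x \<otimes> r \<in> {r \<in> carrier R. r \<otimes> a \<in> I}"
      using assms(2) I.I_l_closed[of "x \<otimes> a" r] by (auto simp: m_assoc m_comm m_lcomm)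
  qed
qed

lemma mem_add_cgenideal_iff:
  "x \<in> I <+>\<^bsub>R\<^esub> PIdl a \<longleftrightarrow> (\<exists>i\<in>I. \<exists>r\<in>carrier R. x = i \<oplus> r \<otimes> a)"
  unfolding set_add_def' cgenideal_def by blast

text \<open>An ideal \<open>M\<close> maximal among those that are not finitely generated is prime.
  If \<open>a b\<close> is in \<open>M\<close> but neither factor is, then M + (a) and the colon
  ideal (M : a) are strictly larger, hence finitely generated, and generators of \<open>M\<close>
  can be assembled from theirs.\<close>

theorem cohen:
  assumes prime_fg: "\<And>P. primeideal P R \<Longrightarrow> \<exists>A\<subseteq>carrier R. finite A \<and> P = Idl A"
  shows "noetherian_ring R"
proof (rule noetherian_ringI, rule ccontr)
  let ?fg = "\<lambda>I. \<exists>A\<subseteq>carrier R. finite A \<and> I = Idl A"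
  let ?Z = "{I. ideal I R \<and> \<not> ?fg I}"
  fix I0 assume I0: "ideal I0 R" "\<not> ?fg I0"
  have "\<exists>M\<in>?Z. \<forall>J\<in>?Z. M \<subseteq> J \<longrightarrow> J = M"
  proof (rule subset_Zorn_nonempty)
    show "?Z \<noteq> {}" using I0 by blast
  next
    fix C assume C: "C \<noteq> {}" "subset.chain ?Z C"
    have "subset.chain {I. ideal I R} C"
      using C(2) by (auto simp: subset.chain_def)
    hence ideal: "ideal (\<Union>C) R"
      using chain_Union_is_ideal[of C] C(1) by auto
    have "\<not> ?fg (\<Union>C)"
    proof
      assume "?fg (\<Union>C)"
      then obtain A where A: "A \<subseteq> carrier R" "finite A" "\<Union>C = Idl A" by blast
      have "A \<subseteq> \<Union>C" using genideal_self[OF A(1)] A(3) by simp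
      then obtain B where B: "B \<in> C" "A \<subseteq> B"
        using finite_subset_Union_chain[OF A(2) _ C] by blast
      have "ideal B R" "\<not> ?fg B" using C(2) B(1) by (auto simp: subset.chain_def)
      moreover have "\<Union>C \<subseteq> B" using genideal_minimal[OF \<open>ideal B R\<close> B(2)] A(3) by simp
      hence "B = Idl A" using B(1) A(3) by blast
      ultimately show False using A by blast
    qed
    with ideal show "\<Union>C \<in> ?Z" by blast
  qed
  then obtain M where M: "ideal M R" "\<not> ?fg M"
    and max: "\<And>J. ideal J R \<Longrightarrow> \<not> ?fg J \<Longrightarrow> M \<subseteq> J \<Longrightarrow> J = M"
    by auto
  interpret M: ideal M R by (rule M(1))
  have "primeideal M R"
  proof (rule primeidealI[OF M(1) cring_axioms])
    show "carrier R \<noteq> M"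
      using genideal_one M(2) by (metis empty_subsetI finite.simps insert_subset one_closed)
  next
    fix a b assume a: "a \<in> carrier R" and b: "b \<in> carrier R" and ab: "a \<otimes> b \<in> M"
    show "a \<in> M \<or> b \<in> M"
    proof (rule ccontr)
      assume "\<not> ?thesis"
      hence nab: "a \<notin> M" "b \<notin> M" by auto
      let ?K = "M <+>\<^bsub>R\<^esub> PIdl a" and ?C = "{r \<in> carrier R. r \<otimes> a \<in> M}"
      have K: "ideal ?K R" using M(1) cgenideal_ideal[OF a] by (rule add_ideals)
      have C: "ideal ?C R" by (rule colon_ideal[OF M(1) a])
      have "m \<in> ?K" if "m \<in> M" for m
        unfolding mem_add_cgenideal_iff using that a M.Icarr
        by (intro bexI[of _ m] bexI[of _ \<zero>]) auto
      hence MK: "M \<subseteq> ?K" by blast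
      have "a \<in> ?K"
        unfolding mem_add_cgenideal_iff using a
        by (intro bexI[of _ \<zero>] bexI[of _ \<one>]) auto
      hence "?fg ?K" using max[OF K _ MK] nab(1) by blast
      then obtain A where A: "A \<subseteq> carrier R" "finite A" "?K = Idl A" by blast
      have "M \<subseteq> ?C" using M.Icarr M.I_r_closed a by auto
      moreover have "b \<in> ?C" using ab a b by (simp add: m_comm)
      ultimately have "?fg ?C" using max[OF C] nab(2) by blast
      then obtain D where D: "D \<subseteq> carrier R" "finite D" "?C = Idl D" by blast
      have "\<forall>x\<in>A. \<exists>m\<in>M. \<exists>r\<in>carrier R. x = m \<oplus> r \<otimes> a"
        using genideal_self[OF A(1)] unfolding A(3)[symmetric] using mem_add_cgenideal_iff by blast
      then obtain m where m: "\<And>x. x \<in> A \<Longrightarrow> m x \<in> M \<and> (\<exists>r\<in>carrier R. x = m x \<oplus> r \<otimes> a)"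
        by metis
      \<comment> \<open>The \<open>M\<close>-parts of the generators of M + (a), together with
        \<open>a\<close> times the generators of (M : a).\<close>
      define G where "G = m ` A \<union> (\<lambda>d. d \<otimes> a) ` D"
      have DC: "D \<subseteq> ?C" using genideal_self[OF D(1)] D(3) by simp
      have GM: "G \<subseteq> M" using m DC by (auto simp: G_def)
      hence Gc: "G \<subseteq> carrier R" using M.Icarr by blast
      have N: "ideal (Idl G) R" by (rule genideal_ideal[OF Gc])
      have "M \<subseteq> Idl G"
      proof
        fix x assume x: "x \<in> M"
        have "A \<subseteq> Idl G <+>\<^bsub>R\<^esub> PIdl a"
          using m genideal_self[OF Gc] by (fastforce simp: mem_add_cgenideal_iff G_def)
        hence "Idl A \<subseteq> Idl G <+>\<^bsub>R\<^esub> PIdl a"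
          using add_ideals[OF N cgenideal_ideal[OF a]] by (intro genideal_minimal)
        hence "x \<in> Idl G <+>\<^bsub>R\<^esub> PIdl a"
          using x MK A(3) by blast
        then obtain g r where gr: "g \<in> Idl G" "r \<in> carrier R" "x = g \<oplus> r \<otimes> a"
          by (auto simp: mem_add_cgenideal_iff)
        have gM: "g \<in> M" using gr(1) genideal_minimal[OF M(1) GM] by blast
        \<comment> \<open>As a difference of two elements of \<open>M\<close>, this product puts
          \<open>r\<close> into (M : a).\<close>
        have "r \<otimes> a = x \<ominus> g"
          using gr(2,3) a M.Icarr[OF gM] by (simp add: minus_eq a_assoc a_comm a_lcomm r_neg2 r_neg1 r_neg)
        also have "\<dots> \<in> M"
          using x gM unfolding minus_eq by (intro M.a_closed M.a_inv_closed)
        finally have "r \<in> Idl D" using gr(2) D(3) by blast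
        also have "Idl D \<subseteq> {r \<in> carrier R. r \<otimes> a \<in> Idl G}"
          using D(1) genideal_self[OF Gc] by (intro genideal_minimal colon_ideal[OF N a]) (auto simp: G_def)
        finally show "x \<in> Idl G"
          using gr(1,3) additive_subgroup.a_closed[OF ideal.axioms(1)[OF N]] by blast
      qed
      hence "M = Idl G" using genideal_minimal[OF M(1) GM] by blast
      moreover have "finite G" using A(2) D(2) by (simp add: G_def)
      ultimately show False using M(2) Gc by blast
    qed
  qed
  with prime_fg M(2) show False by blast
qed

end

section \<open>Ideals of direct limits\<close>

locale direct_system =
  fixes \<phi> :: "nat \<Rightarrow> 'a::comm_ring_1 \<Rightarrow> 'a"
  assumes add: "\<phi> n (x + y) = \<phi> n x + \<phi> n y"
    and mult: "\<phi> n (x * y) = \<phi> n x * \<phi> n y"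
    and one: "\<phi> n 1 = 1"
begin

lemma transition_hom:
  "transition \<phi> n a (x + y) = transition \<phi> n a x + transition \<phi> n a y"
  "transition \<phi> n a (x * y) = transition \<phi> n a x * transition \<phi> n a y"
  "transition \<phi> n a 1 = 1"
  by (induction a) (simp_all add: add mult one)

lemma transition_zero: "transition \<phi> n a 0 = 0"
  using transition_hom(1)[of n a 0 0] by simp

lemma class_eq_iff:
  "dirlim_class \<phi> n x = dirlim_class \<phi> m y \<longleftrightarrow>
     (\<exists>a b. n + a = m + b \<and> transition \<phi> n a x = transition \<phi> m b y)"
  unfolding dirlim_class_def
  by (subst eq_equiv_class_iff[OF equiv_dirlim_rel]) (auto simp: dirlim_rel_def)

lemma class_transition: "dirlim_class \<phi> (n + a) (transition \<phi> n a x) = dirlim_class \<phi> n x"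
  unfolding class_eq_iff by (intro exI[of _ 0] exI[of _ a]) simp

lemma class_Suc: "dirlim_class \<phi> (Suc n) (\<phi> n x) = dirlim_class \<phi> n x"
  using class_transition[of n 1 x] by simp

lemma class_in_carrier: "dirlim_class \<phi> n x \<in> carrier (dirlim \<phi>)"
  by (simp add: dirlim_def dirlim_class_def quotientI)

text \<open>All sufficiently late stages are offered, so that several elements can be moved to a
  common one.\<close>

lemma carrier_stage:
  assumes "C \<in> carrier (dirlim \<phi>)"
  obtains N where "\<And>n. N \<le> n \<Longrightarrow> \<exists>x. C = dirlim_class \<phi> n x"
proof -
  from assms obtain N y where C: "C = dirlim_class \<phi> N y"
    by (auto simp: dirlim_def dirlim_class_def elim!: quotientE)
  have "\<exists>x. C = dirlim_class \<phi> n x" if "N \<le> n" for n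
    using class_transition[of N "n - N" y] that C by auto
  thus ?thesis using that by blast
qed

lemma carrier_stageE:
  assumes "C \<in> carrier (dirlim \<phi>)"
  obtains n x where "C = dirlim_class \<phi> n x"
  using carrier_stage[OF assms] by blast

lemma common_stage2:
  assumes "C \<in> carrier (dirlim \<phi>)" "D \<in> carrier (dirlim \<phi>)"
  obtains n x y where "C = dirlim_class \<phi> n x" "D = dirlim_class \<phi> n y"
proof -
  obtain N M where "\<And>n. N \<le> n \<Longrightarrow> \<exists>x. C = dirlim_class \<phi> n x" "\<And>n. M \<le> n \<Longrightarrow> \<exists>x. D = dirlim_class \<phi> n x"
    using assms carrier_stage by metis
  from this(1)[of "max N M"] this(2)[of "max N M"] show ?thesis using that by auto
qed

lemma common_stage3:
  assumes "C \<in> carrier (dirlim \<phi>)" "D \<in> carrier (dirlim \<phi>)" "E \<in> carrier (dirlim \<phi>)"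
  obtains n x y z where "C = dirlim_class \<phi> n x" "D = dirlim_class \<phi> n y" "E = dirlim_class \<phi> n z"
proof -
  obtain N M K where "\<And>n. N \<le> n \<Longrightarrow> \<exists>x. C = dirlim_class \<phi> n x" "\<And>n. M \<le> n \<Longrightarrow> \<exists>x. D = dirlim_class \<phi> n x"
    "\<And>n. K \<le> n \<Longrightarrow> \<exists>x. E = dirlim_class \<phi> n x"
    using assms carrier_stage by metis
  moreover have "N \<le> N + M + K" "M \<le> N + M + K" "K \<le> N + M + K"
    by auto
  ultimately obtain x y z where "C = dirlim_class \<phi> (N + M + K) x"
    "D = dirlim_class \<phi> (N + M + K) y" "E = dirlim_class \<phi> (N + M + K) z"
    by meson
  thus ?thesis using that by blast
qed

lemma class_mult:
  "dirlim_class \<phi> n x \<otimes>\<^bsub>dirlim \<phi>\<^esub> dirlim_class \<phi> n y = dirlim_class \<phi> n (x * y)"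
  by (rule dirlim_mult) (rule mult)

lemma class_add:
  "dirlim_class \<phi> n x \<oplus>\<^bsub>dirlim \<phi>\<^esub> dirlim_class \<phi> n y = dirlim_class \<phi> n (x + y)"
  by (rule dirlim_add) (rule add)

lemma class_one: "dirlim_class \<phi> n 1 = \<one>\<^bsub>dirlim \<phi>\<^esub>"
  using class_transition[of 0 n 1] by (simp add: transition_hom dirlim_def)

lemma class_zero: "dirlim_class \<phi> n 0 = \<zero>\<^bsub>dirlim \<phi>\<^esub>"
  using class_transition[of 0 n 0] by (simp add: transition_zero dirlim_def)

lemma dirlim_one_closed: "\<one>\<^bsub>dirlim \<phi>\<^esub> \<in> carrier (dirlim \<phi>)"
  and dirlim_zero_closed: "\<zero>\<^bsub>dirlim \<phi>\<^esub> \<in> carrier (dirlim \<phi>)"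
  using class_in_carrier class_one class_zero by metis+

sublocale cring "dirlim \<phi>"
proof (rule cringI)
  show "abelian_group (dirlim \<phi>)"
  proof (rule abelian_groupI)
    fix x y z assume xyz: "x \<in> carrier (dirlim \<phi>)" "y \<in> carrier (dirlim \<phi>)" "z \<in> carrier (dirlim \<phi>)"
    show "(x \<oplus>\<^bsub>dirlim \<phi>\<^esub> y) \<oplus>\<^bsub>dirlim \<phi>\<^esub> z = x \<oplus>\<^bsub>dirlim \<phi>\<^esub> (y \<oplus>\<^bsub>dirlim \<phi>\<^esub> z)"
      using xyz by (rule common_stage3) (simp add: class_add add.assoc)
  next
    fix x y assume xy: "x \<in> carrier (dirlim \<phi>)" "y \<in> carrier (dirlim \<phi>)"
    show "x \<oplus>\<^bsub>dirlim \<phi>\<^esub> y \<in> carrier (dirlim \<phi>)"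
      using xy by (rule common_stage2) (simp add: class_add class_in_carrier)
    show "x \<oplus>\<^bsub>dirlim \<phi>\<^esub> y = y \<oplus>\<^bsub>dirlim \<phi>\<^esub> x"
      using xy by (rule common_stage2) (simp add: class_add add.commute)
  next
    fix x assume x: "x \<in> carrier (dirlim \<phi>)"
    show "\<zero>\<^bsub>dirlim \<phi>\<^esub> \<oplus>\<^bsub>dirlim \<phi>\<^esub> x = x"
    proof -
      obtain n y where "x = dirlim_class \<phi> n y" using x by (rule carrier_stageE)
      thus ?thesis using class_add[of n 0 y] by (simp add: class_zero)
    qed
    obtain n y where "x = dirlim_class \<phi> n y" using x by (rule carrier_stageE)
    hence "dirlim_class \<phi> n (- y) \<oplus>\<^bsub>dirlim \<phi>\<^esub> x = \<zero>\<^bsub>dirlim \<phi>\<^esub>"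
      by (simp add: class_add class_zero)
    thus "\<exists>y\<in>carrier (dirlim \<phi>). y \<oplus>\<^bsub>dirlim \<phi>\<^esub> x = \<zero>\<^bsub>dirlim \<phi>\<^esub>"
      using class_in_carrier by blast
  qed (rule dirlim_zero_closed)
  show "comm_monoid (dirlim \<phi>)"
  proof (rule comm_monoidI)
    fix x y z assume xyz: "x \<in> carrier (dirlim \<phi>)" "y \<in> carrier (dirlim \<phi>)" "z \<in> carrier (dirlim \<phi>)"
    show "(x \<otimes>\<^bsub>dirlim \<phi>\<^esub> y) \<otimes>\<^bsub>dirlim \<phi>\<^esub> z = x \<otimes>\<^bsub>dirlim \<phi>\<^esub> (y \<otimes>\<^bsub>dirlim \<phi>\<^esub> z)"
      using xyz by (rule common_stage3) (simp add: class_mult mult.assoc)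
  next
    fix x y assume xy: "x \<in> carrier (dirlim \<phi>)" "y \<in> carrier (dirlim \<phi>)"
    show "x \<otimes>\<^bsub>dirlim \<phi>\<^esub> y \<in> carrier (dirlim \<phi>)"
      using xy by (rule common_stage2) (simp add: class_mult class_in_carrier)
    show "x \<otimes>\<^bsub>dirlim \<phi>\<^esub> y = y \<otimes>\<^bsub>dirlim \<phi>\<^esub> x"
      using xy by (rule common_stage2) (simp add: class_mult mult.commute)
  next
    fix x assume x: "x \<in> carrier (dirlim \<phi>)"
    show "\<one>\<^bsub>dirlim \<phi>\<^esub> \<otimes>\<^bsub>dirlim \<phi>\<^esub> x = x"
    proof -
      obtain n y where "x = dirlim_class \<phi> n y" using x by (rule carrier_stageE)
      thus ?thesis using class_mult[of n 1 y] by (simp add: class_one)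
    qed
  qed (rule dirlim_one_closed)
  fix x y z assume xyz: "x \<in> carrier (dirlim \<phi>)" "y \<in> carrier (dirlim \<phi>)" "z \<in> carrier (dirlim \<phi>)"
  show "(x \<oplus>\<^bsub>dirlim \<phi>\<^esub> y) \<otimes>\<^bsub>dirlim \<phi>\<^esub> z =
      x \<otimes>\<^bsub>dirlim \<phi>\<^esub> z \<oplus>\<^bsub>dirlim \<phi>\<^esub> y \<otimes>\<^bsub>dirlim \<phi>\<^esub> z"
    using xyz by (rule common_stage3) (simp add: class_add class_mult distrib_right)
qed

lemma ideal_on_stage:
  assumes "ideal I (dirlim \<phi>)"
  shows "ideal_on UNIV {x. dirlim_class \<phi> n x \<in> I}"
proof -
  interpret I: ideal I "dirlim \<phi>" by fact
  have "dirlim_class \<phi> n 0 \<in> I"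
    by (simp add: class_zero)
  moreover have "dirlim_class \<phi> n (x + y) \<in> I" if "dirlim_class \<phi> n x \<in> I" "dirlim_class \<phi> n y \<in> I" for x y
    using I.a_closed[OF that] by (simp add: class_add)
  moreover have "dirlim_class \<phi> n (a * x) \<in> I" if "dirlim_class \<phi> n x \<in> I" for a x
    using I.I_l_closed[OF that class_in_carrier[of n a]] by (simp add: class_mult)
  ultimately show ?thesis
    by (auto simp: ideal_on_def)
qed

lemma prime_on_stage:
  assumes "primeideal P (dirlim \<phi>)"
  shows "prime_on {x. dirlim_class \<phi> n x \<in> P}"
proof -
  interpret P: primeideal P "dirlim \<phi>" by fact
  have "\<one>\<^bsub>dirlim \<phi>\<^esub> \<notin> P"
    using P.I_notcarr P.one_imp_carrier by blast
  moreover have "dirlim_class \<phi> n x \<in> P \<or> dirlim_class \<phi> n y \<in> P" if "dirlim_class \<phi> n (x * y) \<in> P" for x y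
    using P.I_prime[OF class_in_carrier class_in_carrier, of n x n y] that by (simp add: class_mult)
  ultimately show ?thesis
    using ideal_on_stage[OF P.ideal_axioms, of n] by (auto simp: prime_on_def class_one)
qed

text \<open>A prime of the limit is the same as the compatible family of its contractions
  \<open>P n\<close>. Every element of the limit can be moved to a stage after \<open>M\<close>,
  where the transported \<open>F\<close> generates the contraction, so the classes of
  \<open>F\<close> generate the prime.\<close>

theorem noetherian_dirlim:
  assumes fg: "\<And>P. (\<And>n. prime_on (P n)) \<Longrightarrow> (\<And>n. \<phi> n -` P (Suc n) = P n) \<Longrightarrow>
    \<exists>M F. finite F \<and> F \<subseteq> P M \<and> (\<forall>n. P (M + n) \<subseteq> ideal_on UNIV hull (transition \<phi> M n ` F))"
  shows "noetherian_ring (dirlim \<phi>)"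
proof (rule cohen)
  fix P assume P: "primeideal P (dirlim \<phi>)"
  interpret P: primeideal P "dirlim \<phi>" by fact
  let ?P = "\<lambda>n. {x. dirlim_class \<phi> n x \<in> P}"
  have "\<phi> n -` ?P (Suc n) = ?P n" for n
    by (simp add: vimage_def class_Suc)
  with fg[of ?P, OF prime_on_stage[OF P]] obtain M F where F: "finite F" "F \<subseteq> ?P M"
    and hull: "\<And>n. ?P (M + n) \<subseteq> ideal_on UNIV hull (transition \<phi> M n ` F)"
    by blast
  define A where "A = dirlim_class \<phi> M ` F"
  have A: "A \<subseteq> carrier (dirlim \<phi>)" "A \<subseteq> P"
    using F(2) class_in_carrier by (auto simp: A_def)
  have "P \<subseteq> Idl\<^bsub>dirlim \<phi>\<^esub> A"
  proof
    fix C assume C: "C \<in> P"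
    obtain N where "\<And>n. N \<le> n \<Longrightarrow> \<exists>x. C = dirlim_class \<phi> n x"
      using carrier_stage[OF P.Icarr[OF C]] by blast
    then obtain x where x: "C = dirlim_class \<phi> (M + N) x"
      by (metis le_add2)
    have "transition \<phi> M N ` F \<subseteq> {x. dirlim_class \<phi> (M + N) x \<in> Idl\<^bsub>dirlim \<phi>\<^esub> A}"
      using genideal_self[OF A(1)] by (auto simp: class_transition A_def)
    hence "ideal_on UNIV hull (transition \<phi> M N ` F) \<subseteq> {x. dirlim_class \<phi> (M + N) x \<in> Idl\<^bsub>dirlim \<phi>\<^esub> A}"
      using ideal_on_stage[OF genideal_ideal[OF A(1)]] by (rule hull_minimal)
    moreover have "x \<in> ?P (M + N)" using C x by simp
    ultimately show "C \<in> Idl\<^bsub>dirlim \<phi>\<^esub> A"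
      using hull[of N] x by blast
  qed
  moreover have "Idl\<^bsub>dirlim \<phi>\<^esub> A \<subseteq> P"
    using P.ideal_axioms A(2) by (rule genideal_minimal)
  ultimately show "\<exists>A\<subseteq>carrier (dirlim \<phi>). finite A \<and> P = Idl\<^bsub>dirlim \<phi>\<^esub> A"
    using A(1) F(1) by (intro exI[of _ A]) (auto simp: A_def)
qed

end

section \<open>Ring homomorphisms defined on monomials\<close>

text \<open>The additive extension of a map given on terms. \<open>H\<close> receives exponent and
  coefficient together, because both \<open>separate\<close> and \<open>tau\<close> move part of the
  exponent into the coefficient.\<close>

definition monomial_sum :: "('e \<Rightarrow> 'c::zero \<Rightarrow> 'b::comm_monoid_add) \<Rightarrow> ('e \<Rightarrow>\<^sub>0 'c) \<Rightarrow> 'b" where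
  "monomial_sum H f = (\<Sum>e\<in>Poly_Mapping.keys f. H e (Poly_Mapping.lookup f e))"

lemma monomial_sum_superset:
  assumes "\<And>e. H e 0 = 0" "finite E" "Poly_Mapping.keys f \<subseteq> E"
  shows "monomial_sum H f = (\<Sum>e\<in>E. H e (Poly_Mapping.lookup f e))"
  unfolding monomial_sum_def using assms
  by (intro sum.mono_neutral_left) (auto simp: in_keys_iff)

lemma monomial_sum_single:
  assumes "\<And>e. H e 0 = 0"
  shows "monomial_sum H (Poly_Mapping.single e c) = H e c"
  by (subst monomial_sum_superset[of H "{e}"]) (auto simp: assms)

lemma monomial_sum_zero: "monomial_sum H 0 = 0"
  by (simp add: monomial_sum_def)

lemma monomial_sum_add:
  fixes H :: "'e \<Rightarrow> 'c::comm_monoid_add \<Rightarrow> 'b::comm_monoid_add"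
  assumes zero: "\<And>e. H e 0 = 0" and add: "\<And>e c d. H e (c + d) = H e c + H e d"
  shows "monomial_sum H (f + g) = monomial_sum H f + monomial_sum H g"
proof -
  let ?E = "Poly_Mapping.keys f \<union> Poly_Mapping.keys g"
  have "Poly_Mapping.keys (f + g) \<subseteq> ?E"
    by (rule Poly_Mapping.keys_add)
  thus ?thesis
    by (simp add: monomial_sum_superset[of H ?E] zero add lookup_add sum.distrib)
qed

lemma monomial_sum_mult:
  fixes H :: "'e::comm_monoid_add \<Rightarrow> 'c::comm_semiring_0 \<Rightarrow> 'b::comm_semiring_0"
  assumes zero: "\<And>e. H e 0 = 0" and add: "\<And>e c d. H e (c + d) = H e c + H e d"
    and mult: "\<And>e e' c d. H (e + e') (c * d) = H e c * H e' d"
  shows "monomial_sum H (f * g) = monomial_sum H f * monomial_sum H g"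
proof -
  note hom = monomial_sum_add[of H, OF zero add] monomial_sum_zero[of H]
  have mono: "monomial_sum H (Poly_Mapping.single d a * Poly_Mapping.single e b) =
      monomial_sum H (Poly_Mapping.single d a) * monomial_sum H (Poly_Mapping.single e b)" for d e a b
    by (simp add: mult_single monomial_sum_single[of H, OF zero] mult)
  have right: "monomial_sum H (Poly_Mapping.single d a * g) =
      monomial_sum H (Poly_Mapping.single d a) * monomial_sum H g" for d a g
    by (induction g rule: poly_mapping_add_induct) (simp_all only: mono distrib_left hom mult_zero_right)
  show ?thesis
    by (induction f rule: poly_mapping_add_induct) (simp_all only: right distrib_right hom mult_zero_left)
qed

lemma sum_single_lookup: "(\<Sum>e\<in>Poly_Mapping.keys f. Poly_Mapping.single e (Poly_Mapping.lookup f e)) = f"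
proof -
  have "monomial_sum Poly_Mapping.single f = f"
    by (induction f rule: poly_mapping_add_induct)
      (simp_all add: monomial_sum_single monomial_sum_add monomial_sum_zero single_add)
  thus ?thesis by (simp add: monomial_sum_def)
qed

section \<open>Prime ideals extended to polynomial rings\<close>

text \<open>Convolution as a sum over an explicit finite set, from which a single pair can be split
  off.\<close>

lemma lookup_mult_keys:
  fixes F G :: "'o::comm_monoid_add \<Rightarrow>\<^sub>0 'a::comm_semiring_0"
  shows "Poly_Mapping.lookup (F * G) k = (\<Sum>(a, b) \<in> Poly_Mapping.keys F \<times> Poly_Mapping.keys G.
    Poly_Mapping.lookup F a * Poly_Mapping.lookup G b when a + b = k)"
proof -
  have "F * G = (\<Sum>a\<in>Poly_Mapping.keys F. Poly_Mapping.single a (Poly_Mapping.lookup F a)) *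
      (\<Sum>b\<in>Poly_Mapping.keys G. Poly_Mapping.single b (Poly_Mapping.lookup G b))"
    by (simp only: sum_single_lookup)
  also have "\<dots> = (\<Sum>(a, b) \<in> Poly_Mapping.keys F \<times> Poly_Mapping.keys G.
      Poly_Mapping.single (a + b) (Poly_Mapping.lookup F a * Poly_Mapping.lookup G b))"
    by (simp add: sum_product mult_single sum.cartesian_product)
  finally show ?thesis
    by (simp add: lookup_sum lookup_single case_prod_unfold)
qed

text \<open>As in Gauss's lemma, with a total order on the exponents: take in each factor the
  largest exponent with coefficient outside \<open>q\<close>. Modulo \<open>q\<close>, the
  coefficient of the product at their sum is the product of these two coefficients.\<close>

lemma prime_on_coefficients:
  fixes q :: "'a::comm_ring_1 set"
  assumes q: "prime_on q"
  shows "prime_on {F :: 'o::{linorder, ordered_cancel_comm_monoid_add} \<Rightarrow>\<^sub>0 'a. \<forall>m. Poly_Mapping.lookup F m \<in> q}"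
    (is "prime_on ?J")
proof -
  note qI = prime_onD(1)[OF q]
  have "F * G \<in> ?J" if "G \<in> ?J" for F G
    using that by (auto simp: lookup_mult_keys when_def intro!: ideal_on_sum[OF qI] ideal_onD(2,4)[OF qI])
  moreover have "F \<in> ?J \<or> G \<in> ?J" if FG: "F * G \<in> ?J" for F G
  proof (rule ccontr)
    assume neither: "\<not> (F \<in> ?J \<or> G \<in> ?J)"
    define A where "A = {a \<in> Poly_Mapping.keys F. Poly_Mapping.lookup F a \<notin> q}"
    define B where "B = {b \<in> Poly_Mapping.keys G. Poly_Mapping.lookup G b \<notin> q}"
    have keys: "a \<in> Poly_Mapping.keys H" if "Poly_Mapping.lookup H a \<notin> q" for H :: "'o \<Rightarrow>\<^sub>0 'a" and a
      using that ideal_onD(2)[OF qI] by (metis in_keys_iff)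
    have AB: "finite A" "finite B" "A \<noteq> {}" "B \<noteq> {}"
      using neither keys by (auto simp: A_def B_def)
    define a0 b0 where "a0 = Max A" and "b0 = Max B"
    have a0: "a0 \<in> A" and b0: "b0 \<in> B"
      using AB by (simp_all add: a0_def b0_def)
    let ?S = "Poly_Mapping.keys F \<times> Poly_Mapping.keys G"
    let ?t = "\<lambda>(a, b). Poly_Mapping.lookup F a * Poly_Mapping.lookup G b when a + b = a0 + b0"
    have "?t x \<in> q" if x: "x \<in> ?S - {(a0, b0)}" for x
    proof -
      obtain a b where ab: "x = (a, b)" by force
      show ?thesis
      proof (cases "a + b = a0 + b0")
        case True
        \<comment> \<open>Exponents from \<open>A\<close> and \<open>B\<close> with this sum must
          both be the maxima, by strict monotonicity of addition; that pair has been taken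
          out.\<close>
        have "a \<notin> A \<or> b \<notin> B"
        proof (rule ccontr)
          assume "\<not> ?thesis"
          hence "a \<le> a0" "b \<le> b0" using AB by (auto simp: a0_def b0_def)
          hence "a = a0" using True add_less_le_mono[of a a0 b b0] by force
          with x ab True show False by simp
        qed
        with x ab show ?thesis
          using ideal_onD(4,5)[OF qI UNIV_I] True by (auto simp: A_def B_def)
      next
        case False
        thus ?thesis using ideal_onD(2)[OF qI] ab by simp
      qed
    qed
    hence rest: "(\<Sum>x\<in>?S - {(a0, b0)}. ?t x) \<in> q"
      by (intro ideal_on_sum[OF qI]) blast
    have "Poly_Mapping.lookup (F * G) (a0 + b0) =
        Poly_Mapping.lookup F a0 * Poly_Mapping.lookup G b0 + (\<Sum>x\<in>?S - {(a0, b0)}. ?t x)"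
      unfolding lookup_mult_keys using a0 b0 by (subst sum.remove[of _ "(a0, b0)"]) (auto simp: A_def B_def)
    hence "Poly_Mapping.lookup F a0 * Poly_Mapping.lookup G b0 =
        Poly_Mapping.lookup (F * G) (a0 + b0) - (\<Sum>x\<in>?S - {(a0, b0)}. ?t x)"
      by simp
    also have "\<dots> \<in> q"
      using FG by (intro ideal_on_UNIV_diff[OF qI _ rest]) blast
    finally have "Poly_Mapping.lookup F a0 * Poly_Mapping.lookup G b0 \<in> q" .
    hence "Poly_Mapping.lookup F a0 \<in> q \<or> Poly_Mapping.lookup G b0 \<in> q"
      by (rule prime_onD(3)[OF q])
    thus False using a0 b0 by (auto simp: A_def B_def)
  qed
  moreover have "1 \<notin> ?J"
    using prime_onD(2)[OF q] by (auto simp: lookup_one intro!: exI[of _ 0])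
  ultimately show ?thesis
    using ideal_onD(2,3)[OF qI] by (auto simp: prime_on_def ideal_on_def lookup_add)
qed

definition restrict_exponent :: "'v set \<Rightarrow> ('v \<Rightarrow>\<^sub>0 nat) \<Rightarrow> ('v \<Rightarrow>\<^sub>0 nat)" where
  "restrict_exponent V e = Poly_Mapping.Abs_poly_mapping (\<lambda>v. Poly_Mapping.lookup e v when v \<in> V)"

lemma lookup_restrict_exponent:
  "Poly_Mapping.lookup (restrict_exponent V e) v = (Poly_Mapping.lookup e v when v \<in> V)"
proof -
  have "finite {v. (Poly_Mapping.lookup e v when v \<in> V) \<noteq> 0}"
    by (rule finite_subset[OF _ finite_keys[of e]]) (auto simp: in_keys_iff when_def split: if_splits)
  thus ?thesis by (simp add: restrict_exponent_def)
qed

lemma restrict_exponent_add: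
  "restrict_exponent V (d + e) = restrict_exponent V d + restrict_exponent V e"
  by (rule poly_mapping_eqI) (simp add: lookup_restrict_exponent lookup_add when_add_distrib)

lemma restrict_exponent_Compl: "restrict_exponent (- V) e + restrict_exponent V e = e"
  by (rule poly_mapping_eqI) (simp add: lookup_restrict_exponent lookup_add when_def)

lemma restrict_exponent_zero: "restrict_exponent V 0 = 0"
  by (rule poly_mapping_eqI) (simp add: lookup_restrict_exponent)

definition polys_in :: "'v set \<Rightarrow> (('v \<Rightarrow>\<^sub>0 nat) \<Rightarrow>\<^sub>0 'k::comm_ring_1) set" where
  "polys_in V = {f. \<forall>e\<in>Poly_Mapping.keys f. Poly_Mapping.keys e \<subseteq> V}"

lemma polys_in_zero: "0 \<in> polys_in V"
  by (simp add: polys_in_def)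

lemma polys_in_single: "Poly_Mapping.keys e \<subseteq> V \<Longrightarrow> Poly_Mapping.single e c \<in> polys_in V"
  by (auto simp: polys_in_def split: if_splits)

lemma polys_in_add: "f \<in> polys_in V \<Longrightarrow> g \<in> polys_in V \<Longrightarrow> f + g \<in> polys_in V"
  using Poly_Mapping.keys_add[of f g] by (fastforce simp: polys_in_def)

lemma polys_in_mult:
  assumes "f \<in> polys_in V" "g \<in> polys_in V"
  shows "f * g \<in> polys_in V"
  unfolding polys_in_def
proof (intro CollectI ballI)
  fix e assume "e \<in> Poly_Mapping.keys (f * g)"
  then obtain a b where "e = a + b" "a \<in> Poly_Mapping.keys f" "b \<in> Poly_Mapping.keys g"
    using Poly_Mapping.keys_mult[of f g] by blast
  thus "Poly_Mapping.keys e \<subseteq> V"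
    using assms Poly_Mapping.keys_add[of a b] by (fastforce simp: polys_in_def)
qed

lemma polys_in_mono: "V \<subseteq> W \<Longrightarrow> polys_in V \<subseteq> polys_in W"
  by (auto simp: polys_in_def)

text \<open>
  Viewing a polynomial as a polynomial in the variables outside \<open>V\<close>, with coefficients
  in \<open>polys_in V\<close>.
\<close>

definition separate :: "'v set \<Rightarrow> (('v \<Rightarrow>\<^sub>0 nat) \<Rightarrow>\<^sub>0 'k::comm_ring_1) \<Rightarrow> ('v \<Rightarrow>\<^sub>0 nat) \<Rightarrow>\<^sub>0 ('v \<Rightarrow>\<^sub>0 nat) \<Rightarrow>\<^sub>0 'k" where
  "separate V = monomial_sum (\<lambda>e c. Poly_Mapping.single (restrict_exponent (- V) e)
     (Poly_Mapping.single (restrict_exponent V e) c))"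

lemma separate_hom:
  "separate V (f + g) = separate V f + separate V g"
  "separate V (f * g) = separate V f * separate V g"
  "separate V 1 = 1" "separate V 0 = 0"
  "separate V (Poly_Mapping.single e c) =
     Poly_Mapping.single (restrict_exponent (- V) e) (Poly_Mapping.single (restrict_exponent V e) c)"
proof -
  show "separate V (f + g) = separate V f + separate V g"
    unfolding separate_def by (rule monomial_sum_add) (simp_all add: single_add)
  show "separate V (f * g) = separate V f * separate V g"
    unfolding separate_def
    by (rule monomial_sum_mult) (simp_all add: single_add mult_single restrict_exponent_add)
  show single: "separate V (Poly_Mapping.single e c) =
      Poly_Mapping.single (restrict_exponent (- V) e) (Poly_Mapping.single (restrict_exponent V e) c)" for e c
    unfolding separate_def by (subst monomial_sum_single) simp_all
  show "separate V 1 = 1"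
    unfolding single_one[symmetric] single by (simp add: restrict_exponent_zero)
  show "separate V 0 = 0"
    by (simp add: separate_def monomial_sum_zero)
qed

lemma separate_polys_in: "f \<in> polys_in V \<Longrightarrow> separate V f = Poly_Mapping.single 0 f"
proof -
  assume f: "f \<in> polys_in V"
  have "restrict_exponent (- V) e = 0 \<and> restrict_exponent V e = e" if "e \<in> Poly_Mapping.keys f" for e
  proof -
    have "Poly_Mapping.lookup e v = 0" if "v \<notin> V" for v
      using f \<open>e \<in> _\<close> that by (auto simp: polys_in_def simp flip: not_in_keys_iff_lookup_eq_zero)
    thus ?thesis
      by (auto intro!: poly_mapping_eqI simp: lookup_restrict_exponent when_def)
  qed
  hence "separate V f = (\<Sum>e\<in>Poly_Mapping.keys f. Poly_Mapping.single 0 (Poly_Mapping.single e (Poly_Mapping.lookup f e)))"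
    unfolding separate_def monomial_sum_def by (intro sum.cong) auto
  also have "\<dots> = Poly_Mapping.single 0 (\<Sum>e\<in>Poly_Mapping.keys f. Poly_Mapping.single e (Poly_Mapping.lookup f e))"
    by (induction rule: infinite_finite_induct) (simp_all add: single_add)
  finally show ?thesis by (simp only: sum_single_lookup)
qed

lemma lookup_separate_in: "Poly_Mapping.lookup (separate V f) m \<in> polys_in V"
proof (induction f rule: poly_mapping_add_induct)
  case (single a b)
  have "Poly_Mapping.keys (restrict_exponent V a) \<subseteq> V"
    by (auto simp: in_keys_iff lookup_restrict_exponent when_def split: if_splits)
  thus ?case
    by (auto simp: separate_hom lookup_single when_def polys_in_single polys_in_zero)
qed (simp_all add: separate_hom lookup_add polys_in_zero polys_in_add)

lemma separate_sum:
  "f = (\<Sum>m\<in>Poly_Mapping.keys (separate V f). Poly_Mapping.single m 1 * Poly_Mapping.lookup (separate V f) m)"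
proof -
  let ?H = "\<lambda>m g. Poly_Mapping.single m 1 * g"
  have "monomial_sum ?H (separate V f) = f"
    by (induction f rule: poly_mapping_add_induct)
      (simp_all add: separate_hom monomial_sum_zero monomial_sum_add[of ?H] monomial_sum_single[of ?H]
        distrib_left mult_single restrict_exponent_Compl)
  thus ?thesis by (simp add: monomial_sum_def)
qed

text \<open>The generated ideal is the preimage under \<open>separate\<close> of the polynomials
  with all coefficients in \<open>q\<close>. The entire polynomial ring can serve as coefficient
  ring there, since the coefficients that occur lie in \<open>polys_in V\<close> anyway.\<close>

lemma prime_on_extension:
  fixes q :: "(('v::linorder \<Rightarrow>\<^sub>0 nat) \<Rightarrow>\<^sub>0 'k::comm_ring_1) set"
  assumes "prime_on q"
  shows "prime_on (ideal_on UNIV hull (q \<inter> polys_in V))"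
proof -
  let ?J = "separate V -` {F. \<forall>m. Poly_Mapping.lookup F m \<in> q}"
  have J: "prime_on ?J"
    using prime_on_coefficients[OF assms] by (intro prime_on_vimage) (simp_all add: separate_hom)
  have "q \<inter> polys_in V \<subseteq> ?J"
    using ideal_onD(2)[OF prime_onD(1)[OF assms]] by (auto simp: separate_polys_in lookup_single when_def)
  hence "ideal_on UNIV hull (q \<inter> polys_in V) \<subseteq> ?J"
    using prime_onD(1)[OF J] by (rule hull_minimal)
  moreover have "?J \<subseteq> ideal_on UNIV hull (q \<inter> polys_in V)"
  proof
    fix f assume f: "f \<in> ?J"
    note I = ideal_on_UNIV_hull[of "q \<inter> polys_in V"]
    show "f \<in> ideal_on UNIV hull (q \<inter> polys_in V)"
      by (subst separate_sum[of f V], rule ideal_on_sum[OF I], rule ideal_onD(4)[OF I UNIV_I], rule hull_inc)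
        (use f lookup_separate_in in auto)
  qed
  ultimately show ?thesis using J by simp
qed

text \<open>\<open>frac\<close> says that the target consists of fractions with denominators of
  invertible image, and \<open>no_unit\<close> that \<open>J\<close> avoids these denominators. The
  extension of \<open>J\<close> is then the set \<open>?Q\<close> of fractions with numerator in
  \<open>J\<close>.\<close>

lemma prime_on_localization:
  fixes h :: "'a::comm_ring_1 \<Rightarrow> 'b::comm_ring_1"
  assumes add: "\<And>x y. h (x + y) = h x + h y" and mult: "\<And>x y. h (x * y) = h x * h y" and one: "h 1 = 1"
    and inj: "inj h" and frac: "\<And>g. \<exists>u f. h u dvd 1 \<and> g * h u = h f"
    and J: "prime_on J" and no_unit: "\<And>u. u \<in> J \<Longrightarrow> \<not> h u dvd 1"
  shows "prime_on (ideal_on UNIV hull (h ` J))"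
proof -
  note JI = prime_onD(1)[OF J]
  let ?Q = "{g. \<exists>u f. f \<in> J \<and> h u dvd 1 \<and> g * h u = h f}"
  have "h 0 = 0" using add[of 0 0] by simp
  hence zero: "0 \<in> ?Q"
    using one ideal_onD(2)[OF JI] by (intro CollectI exI[of _ 1] exI[of _ 0]) auto
  have plus: "x + y \<in> ?Q" if "x \<in> ?Q" "y \<in> ?Q" for x y
  proof -
    obtain u f v g where "f \<in> J" "h u dvd 1" "x * h u = h f" "g \<in> J" "h v dvd 1" "y * h v = h g"
      using \<open>x \<in> ?Q\<close> \<open>y \<in> ?Q\<close> by blast
    moreover have "(x + y) * h (u * v) = (x * h u) * h v + (y * h v) * h u"
      by (simp add: mult algebra_simps)
    ultimately have "h (u * v) dvd 1 \<and> (x + y) * h (u * v) = h (f * v + g * u)" "f * v + g * u \<in> J"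
      using ideal_onD(3,5)[OF JI] mult_dvd_mono[of "h u" 1 "h v" 1] by (auto simp: add mult)
    thus ?thesis by blast
  qed
  have times: "a * x \<in> ?Q" if "x \<in> ?Q" for a x
  proof -
    obtain u f v g where "f \<in> J" "h u dvd 1" "x * h u = h f" "h v dvd 1" "a * h v = h g"
      using \<open>x \<in> ?Q\<close> frac[of a] by blast
    moreover have "(a * x) * h (u * v) = (a * h v) * (x * h u)"
      by (simp add: mult algebra_simps)
    ultimately have "h (u * v) dvd 1 \<and> (a * x) * h (u * v) = h (g * f)" "g * f \<in> J"
      using ideal_onD(4)[OF JI] mult_dvd_mono[of "h u" 1 "h v" 1] by (auto simp: mult)
    thus ?thesis by blast
  qed
  have QI: "ideal_on UNIV ?Q"
    unfolding ideal_on_def by (intro conjI ballI subset_UNIV zero plus times)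
  have "prime_on ?Q"
    unfolding prime_on_def
  proof (intro conjI allI impI QI)
    show "1 \<notin> ?Q"
      using no_unit inj by (auto simp: inj_eq)
    fix x y assume "x * y \<in> ?Q"
    then obtain w k where k: "k \<in> J" "h w dvd 1" "x * y * h w = h k" by blast
    obtain u f v g where uf: "h u dvd 1" "x * h u = h f" and vg: "h v dvd 1" "y * h v = h g"
      using frac[of x] frac[of y] by blast
    have "h (f * g * w) = (x * h u) * (y * h v) * h w"
      by (simp add: mult uf vg)
    also have "\<dots> = (x * y * h w) * h (u * v)"
      by (simp add: mult algebra_simps)
    also have "\<dots> = h (k * (u * v))"
      by (simp add: k(3) mult)
    \<comment> \<open>Injectivity carries the equation back to numerators, where \<open>J\<close> is
      prime and does not contain the denominator \<open>w\<close>.\<close>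
    finally have "f * g * w = k * (u * v)"
      using inj by (simp add: inj_eq)
    hence "f * g * w \<in> J"
      using ideal_onD(5)[OF JI UNIV_I k(1)] by simp
    hence "f \<in> J \<or> g \<in> J"
      using prime_onD(3)[OF J] no_unit k(2) by blast
    thus "x \<in> ?Q \<or> y \<in> ?Q"
      using uf vg by blast
  qed
  moreover have "ideal_on UNIV hull (h ` J) = ?Q"
  proof (rule hull_unique[where S = "ideal_on UNIV"])
    show "h ` J \<subseteq> ?Q"
    proof
      fix g assume "g \<in> h ` J"
      then obtain f where "f \<in> J" "h 1 dvd 1" "g * h 1 = h f"
        using one by auto
      thus "g \<in> ?Q" by blast
    qed
    fix I assume I: "h ` J \<subseteq> I" "ideal_on UNIV I"
    show "?Q \<subseteq> I"
    proof
      fix g assume "g \<in> ?Q"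
      then obtain u f v where "f \<in> J" "g * h u = h f" "1 = h u * v" by (auto elim!: dvdE)
      hence "g = h f * v" by (metis mult.assoc mult.right_neutral)
      thus "g \<in> I" using I \<open>f \<in> J\<close> ideal_onD(5) by blast
    qed
  qed (rule QI)
  ultimately show ?thesis by simp
qed

section \<open>Stages of the limit as localizations of one polynomial ring\<close>

lemma Fract_one_hom:
  "Fraction_Field.Fract (a + b) 1 = Fraction_Field.Fract a 1 + Fraction_Field.Fract b 1"
  "Fraction_Field.Fract (a * b) 1 = Fraction_Field.Fract a 1 * Fraction_Field.Fract b 1"
  "Fraction_Field.Fract a 1 = 0 \<longleftrightarrow> a = 0"
  "Fraction_Field.Fract (0::'a::idom) 1 = 0" "Fraction_Field.Fract (1::'a) 1 = 1"
  by (simp_all add: Zero_fract_def One_fract_def eq_fract)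

lemma Fract_one_sum: "Fraction_Field.Fract (sum f A) (1::'a::idom) = (\<Sum>x\<in>A. Fraction_Field.Fract (f x) 1)"
  by (induction A rule: infinite_finite_induct) (simp_all add: Fract_one_hom del: add_fract mult_fract)

lemma Fract_one_power: "Fraction_Field.Fract (a ^ n) (1::'a::idom) = Fraction_Field.Fract a 1 ^ n"
  by (induction n) (simp_all add: Fract_one_hom del: add_fract mult_fract)

lemma Fract_one_prod: "Fraction_Field.Fract (prod f A) (1::'a::idom) = (\<Prod>x\<in>A. Fraction_Field.Fract (f x) 1)"
  by (induction A rule: infinite_finite_induct) (simp_all add: Fract_one_hom del: add_fract mult_fract)

lemma power_single_one:
  "(Poly_Mapping.single (Poly_Mapping.single v 1) 1 :: ('v \<Rightarrow>\<^sub>0 nat) \<Rightarrow>\<^sub>0 'k::comm_ring_1) ^ n =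
     Poly_Mapping.single (Poly_Mapping.single v n) 1"
  by (induction n) (simp_all add: mult_single flip: single_add)

lemma prod_single_one:
  "(\<Prod>x\<in>A. Poly_Mapping.single (f x) (1::'k::comm_ring_1)) = Poly_Mapping.single (\<Sum>x\<in>A. f x) 1"
  by (induction A rule: infinite_finite_induct) (simp_all add: mult_single)

type_synonym ('k, 'd) xpoly = "(('d \<times> nat) \<Rightarrow>\<^sub>0 nat) \<Rightarrow>\<^sub>0 'k"

text \<open>
  At stage \<open>n\<close> the variables of \<open>('k, 'd) xpoly\<close> stand for
  \<open>alpha j 0\<close> (variable \<open>(j, 0)\<close>), the inverse of \<open>tvar j\<close> of stage
  \<open>m\<close> (variable \<open>(j, m + 1)\<close>, for \<open>m \<le> n\<close>), and
  \<open>alpha j m\<close> (variable \<open>(j, m + 1)\<close>, for \<open>m > n\<close>). A monomial in the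
  inverses of the \<open>tvar j\<close> of the stages up to \<open>m\<close> contains \<open>tvar j\<close> of stage
  \<open>m\<close> with exponent \<open>- weight p e j m\<close>.
\<close>

fun weight :: "(nat \<Rightarrow> nat) \<Rightarrow> (('d \<times> nat) \<Rightarrow>\<^sub>0 nat) \<Rightarrow> 'd \<Rightarrow> nat \<Rightarrow> nat" where
  "weight p e j 0 = Poly_Mapping.lookup e (j, 1)"
| "weight p e j (Suc m) = p m * weight p e j m + Poly_Mapping.lookup e (j, Suc (Suc m))"

text \<open>The inverse of \<open>tvar j\<close> of stage m becomes \<open>alpha j (m + 1)\<close>
  times the \<open>p m\<close>-th power of the next inverse. Hence each unit of weight at stage
  \<open>l - 1\<close> contributes one factor \<open>alpha j l\<close> on the way to stage
  \<open>l\<close>. The second index shifts by one for l > n, where the variable is an \<alpha>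
  itself.\<close>

definition alpha_exponent :: "(nat \<Rightarrow> nat) \<Rightarrow> nat \<Rightarrow> (('d \<times> nat) \<Rightarrow>\<^sub>0 nat) \<Rightarrow> (('d \<times> nat) \<Rightarrow>\<^sub>0 nat)" where
  "alpha_exponent p n e = Poly_Mapping.Abs_poly_mapping (\<lambda>(j, l).
     if l = 0 then Poly_Mapping.lookup e (j, 0)
     else if l \<le> n then weight p e j (l - 1) else Poly_Mapping.lookup e (j, Suc l))"

definition tvar_exponent :: "(nat \<Rightarrow> nat) \<Rightarrow> nat \<Rightarrow> (('d::finite \<times> nat) \<Rightarrow>\<^sub>0 nat) \<Rightarrow> ('d \<Rightarrow>\<^sub>0 int)" where
  "tvar_exponent p n e = Poly_Mapping.Abs_poly_mapping (\<lambda>j. - int (weight p e j n))"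

text \<open>Letting the variables stand for the inverses of the \<open>tvar j\<close> makes every
  exponent of an \<alpha> nonnegative, so that monomials have polynomial coefficients, with
  denominator 1. The \<open>tvar j\<close> themselves would bring in inverses of \<alpha>.\<close>

definition tau :: "(nat \<Rightarrow> nat) \<Rightarrow> nat \<Rightarrow> ('k::field_char_0, 'd::{finite,linorder}) xpoly \<Rightarrow> ('k, 'd) laurent" where
  "tau p n = monomial_sum (\<lambda>e c. Poly_Mapping.single (tvar_exponent p n e)
     (Fraction_Field.Fract (Poly_Mapping.single (alpha_exponent p n e) c) 1))"

lemma lookup_tvar_exponent: "Poly_Mapping.lookup (tvar_exponent p n e) j = - int (weight p e j n)"
  by (simp add: tvar_exponent_def)

lemma lookup_alpha_exponent:
  fixes e :: "('d::finite \<times> nat) \<Rightarrow>\<^sub>0 nat"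
  shows "Poly_Mapping.lookup (alpha_exponent p n e) (j, l) =
    (if l = 0 then Poly_Mapping.lookup e (j, 0)
     else if l \<le> n then weight p e j (l - 1) else Poly_Mapping.lookup e (j, Suc l))"
proof -
  let ?f = "\<lambda>(j, l). if l = 0 then Poly_Mapping.lookup e (j, 0)
     else if l \<le> n then weight p e j (l - 1) else Poly_Mapping.lookup e (j, Suc l)"
  have "{x. ?f x \<noteq> 0} \<subseteq> UNIV \<times> {..n} \<union> (\<lambda>(j, l). (j, l - 1)) ` Poly_Mapping.keys e"
  proof
    fix x assume x: "x \<in> {x. ?f x \<noteq> 0}"
    obtain j l where jl: "x = (j, l)" by force
    show "x \<in> UNIV \<times> {..n} \<union> (\<lambda>(j, l). (j, l - 1)) ` Poly_Mapping.keys e"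
    proof (cases "l \<le> n")
      case False
      hence "(j, Suc l) \<in> Poly_Mapping.keys e" using x jl by (auto simp: in_keys_iff)
      thus ?thesis unfolding jl by (intro UnI2 rev_image_eqI) auto
    qed (simp add: jl)
  qed
  hence "finite {x. ?f x \<noteq> 0}"
    by (rule finite_subset) auto
  thus ?thesis by (simp add: alpha_exponent_def)
qed

lemma weight_add: "weight p (d + e) j m = weight p d j m + weight p e j m"
  by (induction m) (simp_all add: lookup_add algebra_simps)

lemma tvar_exponent_add: "tvar_exponent p n (d + e) = tvar_exponent p n d + tvar_exponent p n e"
  by (rule poly_mapping_eqI) (simp add: lookup_tvar_exponent lookup_add weight_add)

lemma alpha_exponent_add: "alpha_exponent p n (d + e) = alpha_exponent p n d + alpha_exponent p n e"
  for d e :: "('d::finite \<times> nat) \<Rightarrow>\<^sub>0 nat"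
proof (rule poly_mapping_eqI)
  fix k :: "'d \<times> nat"
  show "Poly_Mapping.lookup (alpha_exponent p n (d + e)) k = Poly_Mapping.lookup (alpha_exponent p n d + alpha_exponent p n e) k"
    by (cases k) (simp add: lookup_alpha_exponent lookup_add weight_add)
qed

lemma tvar_exponent_zero: "tvar_exponent p n 0 = 0"
  using tvar_exponent_add[of p n 0 0] by simp

lemma alpha_exponent_zero: "alpha_exponent p n (0 :: ('d::finite \<times> nat) \<Rightarrow>\<^sub>0 nat) = 0"
  using alpha_exponent_add[of p n 0 "0 :: ('d \<times> nat) \<Rightarrow>\<^sub>0 nat"] by simp

lemma tau_hom:
  fixes f g :: "('k::field_char_0, 'd::{finite,linorder}) xpoly" and e :: "('d \<times> nat) \<Rightarrow>\<^sub>0 nat" and c :: 'k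
  shows
  "tau p n (f + g) = tau p n f + tau p n g"
  "tau p n (f * g) = tau p n f * tau p n g"
  "tau p n (1 :: ('k, 'd) xpoly) = 1" "tau p n (0 :: ('k, 'd) xpoly) = 0"
  "tau p n (Poly_Mapping.single e c) = Poly_Mapping.single (tvar_exponent p n e)
     (Fraction_Field.Fract (Poly_Mapping.single (alpha_exponent p n e) c) 1)"
proof -
  show "tau p n (f + g) = tau p n f + tau p n g"
    unfolding tau_def by (rule monomial_sum_add) (simp_all add: single_add Fract_one_hom del: add_fract mult_fract)
  show "tau p n (f * g) = tau p n f * tau p n g"
    unfolding tau_def
    by (rule monomial_sum_mult)
      (simp_all add: single_add Fract_one_hom(1,4) mult_single tvar_exponent_add alpha_exponent_add
        del: add_fract)
  show single: "tau p n (Poly_Mapping.single e c) = Poly_Mapping.single (tvar_exponent p n e)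
     (Fraction_Field.Fract (Poly_Mapping.single (alpha_exponent p n e) c) 1)" for e :: "('d \<times> nat) \<Rightarrow>\<^sub>0 nat" and c :: 'k
    unfolding tau_def by (subst monomial_sum_single) (simp_all add: Fract_one_hom del: add_fract mult_fract)
  show "tau p n (1 :: ('k, 'd) xpoly) = 1"
    unfolding single_one[symmetric] single
    by (simp add: tvar_exponent_zero alpha_exponent_zero Fract_one_hom(5))
  show "tau p n (0 :: ('k, 'd) xpoly) = 0"
    by (simp add: tau_def monomial_sum_zero)
qed

text \<open>Together the two exponents record all weights up to \<open>n\<close>, and the recursion
  for \<open>weight\<close> is triangular: the exponent at \<open>(j, m + 2)\<close> is the weight
  at m + 1 minus \<open>p m\<close> times the weight at m.\<close>

lemma tau_exponents_inj:
  assumes t: "tvar_exponent p n d = tvar_exponent p n e" and a: "alpha_exponent p n d = alpha_exponent p n e"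
  shows "d = e"
proof (rule poly_mapping_eqI)
  fix k :: "'a \<times> nat"
  obtain j l where k: "k = (j, l)" by force
  have w: "weight p d j m = weight p e j m" if "m \<le> n" for m
  proof (cases "m = n")
    case True
    show ?thesis
      using arg_cong[OF t, of "\<lambda>x. Poly_Mapping.lookup x j"] True by (simp add: lookup_tvar_exponent)
  next
    case False
    with that show ?thesis
      using arg_cong[OF a, of "\<lambda>x. Poly_Mapping.lookup x (j, Suc m)"] by (simp add: lookup_alpha_exponent)
  qed
  consider "l = 0" | "l = 1" | m where "l = Suc (Suc m)" "Suc m \<le> n" | m where "l = Suc (Suc m)" "n < Suc m"
    by (metis One_nat_def not0_implies_Suc not_le)
  thus "Poly_Mapping.lookup d k = Poly_Mapping.lookup e k"
  proof cases
    case 1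
    thus ?thesis
      using arg_cong[OF a, of "\<lambda>x. Poly_Mapping.lookup x (j, 0)"] k by (simp add: lookup_alpha_exponent)
  next
    case 2
    thus ?thesis using w[of 0] k by simp
  next
    case 3
    thus ?thesis using w[of m] w[of "Suc m"] k by simp
  next
    case 4
    thus ?thesis
      using arg_cong[OF a, of "\<lambda>x. Poly_Mapping.lookup x (j, Suc m)"] k by (simp add: lookup_alpha_exponent)
  qed
qed

text \<open>Monomials of \<open>h\<close> with the same \<open>tvar_exponent\<close> meet in one
  coefficient of the image. Inside that coefficient their \<open>alpha_exponent\<close>s differ, so
  nothing cancels.\<close>

lemma inj_tau: "inj (tau p n :: ('k::field_char_0, 'd::{finite,linorder}) xpoly \<Rightarrow> _)"
proof (rule injI)
  fix f g :: "('k, 'd) xpoly"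
  assume eq: "tau p n f = tau p n g"
  have "tau p n (f - g) + tau p n g = tau p n f"
    by (simp flip: tau_hom(1))
  hence zero: "tau p n (f - g) = 0" using eq by simp
  have "h = 0" if h: "tau p n h = 0" for h :: "('k, 'd) xpoly"
  proof (rule ccontr)
    assume "h \<noteq> 0"
    then obtain d where d: "d \<in> Poly_Mapping.keys h"
      by (metis lookup_zero poly_mapping_eqI in_keys_iff)
    let ?S = "{e \<in> Poly_Mapping.keys h. tvar_exponent p n e = tvar_exponent p n d}"
    let ?A = "\<Sum>e\<in>?S. Poly_Mapping.single (alpha_exponent p n e) (Poly_Mapping.lookup h e)"
    have "0 = Poly_Mapping.lookup (tau p n h) (tvar_exponent p n d)"
      using h by simp
    also have "\<dots> = (\<Sum>e\<in>Poly_Mapping.keys h.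
        if tvar_exponent p n e = tvar_exponent p n d
        then Fraction_Field.Fract (Poly_Mapping.single (alpha_exponent p n e) (Poly_Mapping.lookup h e)) 1 else 0)"
      by (simp add: tau_def monomial_sum_def lookup_sum lookup_single when_def)
    also have "\<dots> = Fraction_Field.Fract ?A 1"
      unfolding Fract_one_sum by (rule sum.inter_filter[OF finite_keys, symmetric])
    finally have "Fraction_Field.Fract ?A 1 = 0" ..
    hence A0: "?A = 0" by (rule Fract_one_hom(3)[THEN iffD1])
    have "0 = Poly_Mapping.lookup ?A (alpha_exponent p n d)"
      unfolding A0 by (rule lookup_zero[symmetric])
    also have "\<dots> = (\<Sum>e\<in>?S. if e = d then Poly_Mapping.lookup h e else 0)"
      unfolding lookup_sum by (rule sum.cong) (auto simp: lookup_single when_def dest: tau_exponents_inj)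
    also have "\<dots> = Poly_Mapping.lookup h d"
      using d by (subst sum.delta) auto
    finally show False using d by (simp add: in_keys_iff)
  qed
  from this[OF zero] show "f = g" by simp
qed

lemma alpha_eq_single: "alpha j n = Fraction_Field.Fract (Poly_Mapping.single (Poly_Mapping.single (j, n) 1) 1) 1"
  by (simp add: alpha_def)

text \<open>The variables whose interpretation no longer changes from stage \<open>n\<close> on. The
  variable \<open>(j, n + 2)\<close> is the first that does: it means \<open>alpha j (n + 1)\<close>
  at stage \<open>n\<close> and an inverse of \<open>tvar j\<close> at the next stage.\<close>

definition early_variables :: "nat \<Rightarrow> ('d \<times> nat) set" where
  "early_variables n = {(j, m). m \<le> Suc n}"

lemma phi_sum: "phi p n (sum f A) = (\<Sum>x\<in>A. phi p n (f x))"
  by (induction A rule: infinite_finite_induct) (simp_all add: phi_zero phi_add)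

lemma tau_sum: "tau p n (sum f A) = (\<Sum>x\<in>A. tau p n (f x))"
  by (induction A rule: infinite_finite_induct) (simp_all add: tau_hom)

text \<open>With the variables \<open>(j, n + 2)\<close> absent, scaling by \<open>p n\<close> is
  exactly one step of \<open>weight\<close>, and the scalar that \<open>phi\<close> introduces is
  \<open>alpha j (n + 1)\<close> to the weight at \<open>n\<close>.\<close>

lemma phi_tau:
  fixes f :: "('k::field_char_0, 'd::{finite,linorder}) xpoly"
  assumes "f \<in> polys_in (early_variables n)"
  shows "phi p n (tau p n f) = tau p (Suc n) f"
proof -
  have mono: "phi p n (tau p n (Poly_Mapping.single e c)) = tau p (Suc n) (Poly_Mapping.single e c)"
    if e: "Poly_Mapping.keys e \<subseteq> early_variables n" for e :: "('d \<times> nat) \<Rightarrow>\<^sub>0 nat" and c :: 'k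
  proof -
    have late: "Poly_Mapping.lookup e (j, l) = 0" if "l > Suc n" for j l
      using e that by (force simp: early_variables_def in_keys_iff)
    have t: "Poly_Mapping.map (\<lambda>a. int (p n) * a) (tvar_exponent p n e) = tvar_exponent p (Suc n) e"
      by (rule poly_mapping_eqI) (simp add: lookup_scale lookup_tvar_exponent late)
    have s: "Poly_Mapping.lookup (\<Sum>j\<in>UNIV. Poly_Mapping.single (j, Suc n) (weight p e j n)) (i, l) =
        (weight p e i n when l = Suc n)" for i l
      by (auto simp: lookup_sum lookup_single when_def if_distrib[of "\<lambda>x. x = _"] cong: if_cong)
    have a: "alpha_exponent p n e + (\<Sum>j\<in>UNIV. Poly_Mapping.single (j, Suc n) (weight p e j n)) =
        alpha_exponent p (Suc n) e"
    proof (rule poly_mapping_eqI)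
      fix k :: "'d \<times> nat"
      obtain i l where k: "k = (i, l)" by force
      show "Poly_Mapping.lookup (alpha_exponent p n e + (\<Sum>j\<in>UNIV. Poly_Mapping.single (j, Suc n) (weight p e j n))) k =
          Poly_Mapping.lookup (alpha_exponent p (Suc n) e) k"
        unfolding k lookup_add s by (auto simp: lookup_alpha_exponent late le_Suc_eq)
    qed
    have power: "(alpha j (Suc n) :: ('k, 'd) ratfun) ^ w =
        Fraction_Field.Fract (Poly_Mapping.single (Poly_Mapping.single (j, Suc n) w) 1) 1" for j w
      by (simp only: alpha_eq_single Fract_one_power[symmetric] power_single_one)
    have "(\<Prod>j\<in>UNIV. alpha j (Suc n) powi (- Poly_Mapping.lookup (tvar_exponent p n e) j)) =
        (\<Prod>j\<in>UNIV. Fraction_Field.Fract (Poly_Mapping.single (Poly_Mapping.single (j, Suc n) (weight p e j n)) (1::'k)) 1)"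
      by (simp add: lookup_tvar_exponent power)
    also have "\<dots> = Fraction_Field.Fract (Poly_Mapping.single (\<Sum>j\<in>UNIV. Poly_Mapping.single (j, Suc n) (weight p e j n)) 1) 1"
      by (simp only: Fract_one_prod[symmetric] prod_single_one)
    finally show ?thesis
      by (simp add: tau_hom phi_single t mult_single a)
  qed
  have "phi p n (tau p n f) = (\<Sum>e\<in>Poly_Mapping.keys f. phi p n (tau p n (Poly_Mapping.single e (Poly_Mapping.lookup f e))))"
    by (simp only: tau_sum[symmetric] phi_sum[symmetric] sum_single_lookup)
  also have "\<dots> = (\<Sum>e\<in>Poly_Mapping.keys f. tau p (Suc n) (Poly_Mapping.single e (Poly_Mapping.lookup f e)))"
    using assms by (intro sum.cong mono) (auto simp: polys_in_def)
  also have "\<dots> = tau p (Suc n) f"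
    by (simp only: tau_sum[symmetric] sum_single_lookup)
  finally show ?thesis .
qed

section \<open>Generators of the Laurent polynomial ring, and its Noetherian property\<close>

lemma lconst_hom:
  "lconst (a + b) = lconst a + lconst b" "lconst (a * b) = lconst a * lconst b"
  "lconst 1 = 1" "lconst 0 = 0" "lconst (- a) = - lconst a"
  by (simp_all add: lconst_def single_add mult_single single_uminus)

lemma single_mult_inverse:
  "c \<noteq> 0 \<Longrightarrow> Poly_Mapping.single e c * Poly_Mapping.single (- e) (inverse c) = 1"
  for e :: "'d \<Rightarrow>\<^sub>0 int" and c :: "'a::field"
  by (simp add: mult_single)

lemma single_dvd_one: "c \<noteq> 0 \<Longrightarrow> Poly_Mapping.single e c dvd 1"
  for e :: "'d \<Rightarrow>\<^sub>0 int" and c :: "'a::field"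
  using single_mult_inverse[of c e] by (metis dvd_triv_left)

lemma laurent_generated:
  fixes C :: "('k::field_char_0, 'd::{finite,linorder}) laurent set"
  assumes add: "\<And>x y. x \<in> C \<Longrightarrow> y \<in> C \<Longrightarrow> x + y \<in> C"
    and mult: "\<And>x y. x \<in> C \<Longrightarrow> y \<in> C \<Longrightarrow> x * y \<in> C"
    and const: "\<And>c. lconst c \<in> C"
    and tvar: "\<And>j. tvar j \<in> C" "\<And>j. Poly_Mapping.single (Poly_Mapping.single j (- 1)) 1 \<in> C"
  shows "g \<in> C"
proof -
  have one: "1 \<in> C" and zero: "0 \<in> C"
    using const[of 1] const[of 0] by (simp_all add: lconst_hom)
  have pow: "x ^ m \<in> C" if "x \<in> C" for x and m :: nat
    using that by (induction m) (auto intro: one mult)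
  have single_pow: "(Poly_Mapping.single (Poly_Mapping.single j a) 1 :: ('k, 'd) laurent) ^ m =
      Poly_Mapping.single (Poly_Mapping.single j (int m * a)) 1" for j :: 'd and a m
    by (induction m) (simp_all add: mult_single algebra_simps flip: single_add)
  have mono: "Poly_Mapping.single e 1 \<in> C" for e :: "'d \<Rightarrow>\<^sub>0 int"
  proof (induction e rule: poly_mapping_add_induct)
    case zero
    show ?case using one by simp
  next
    case (single j k)
    show ?case
    proof (cases k)
      case (nonneg m)
      thus ?thesis using pow[OF tvar(1)[of j], of m] by (simp add: tvar_def single_pow)
    next
      case (neg m)
      thus ?thesis using pow[OF tvar(2)[of j], of "Suc m"] by (simp add: single_pow del: power_Suc of_nat_Suc)
    qed
  next
    case (add d e)
    thus ?case using mult[of "Poly_Mapping.single d 1" "Poly_Mapping.single e 1"] by (simp add: mult_single)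
  qed
  show ?thesis
  proof (induction g rule: poly_mapping_add_induct)
    case (single e c)
    show ?case using mult[OF const[of c] mono[of e]] by (simp add: lconst_def mult_single)
  qed (auto intro: zero add)
qed

text \<open>Closure under inverses supplies both the denominators of rational functions and the
  negative powers of the variables. It serves as an induction principle for membership in sets of
  fractions.\<close>

lemma laurent_generated_with_inverses:
  fixes C :: "('k::field_char_0, 'd::{finite,linorder}) laurent set"
  assumes add: "\<And>x y. x \<in> C \<Longrightarrow> y \<in> C \<Longrightarrow> x + y \<in> C"
    and mult: "\<And>x y. x \<in> C \<Longrightarrow> y \<in> C \<Longrightarrow> x * y \<in> C"
    and inverse: "\<And>x y. x \<in> C \<Longrightarrow> x * y = 1 \<Longrightarrow> y \<in> C"
    and const: "\<And>c. lconst (Fraction_Field.Fract (Poly_Mapping.single 0 c) 1) \<in> C"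
    and alpha: "\<And>j l. lconst (alpha j l) \<in> C"
    and tvar: "\<And>j. tvar j \<in> C"
  shows "g \<in> C"
proof (rule laurent_generated[OF add mult])
  have one: "1 \<in> C" and zero: "0 \<in> C"
    using const[of 1] const[of 0] by (simp_all add: Fract_one_hom(4,5) lconst_hom)
  have pow: "x ^ m \<in> C" if "x \<in> C" for x and m :: nat
    using that by (induction m) (auto intro: one mult)
  let ?L = "\<lambda>A. lconst (Fraction_Field.Fract A 1) :: ('k, 'd) laurent"
  have mono: "?L (Poly_Mapping.single e 1) \<in> C" for e :: "('d \<times> nat) \<Rightarrow>\<^sub>0 nat"
  proof (induction e rule: poly_mapping_add_induct)
    case zero
    show ?case using one by (simp add: Fract_one_hom(5) lconst_hom)
  next
    case (single v k)
    have L_pow: "?L A ^ k = ?L (A ^ k)" for A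
      by (induction k) (simp_all add: Fract_one_hom(5) lconst_hom(3) flip: lconst_hom(2))
    show ?case
      using pow[OF alpha[of "fst v" "snd v"], of k] by (simp only: alpha_eq_single L_pow power_single_one prod.collapse)
  next
    case (add d e)
    thus ?case
      using mult[of "?L (Poly_Mapping.single d 1)" "?L (Poly_Mapping.single e 1)"]
      by (simp add: mult_single flip: lconst_hom(2))
  qed
  have poly: "?L A \<in> C" for A
  proof (induction A rule: poly_mapping_add_induct)
    case (single e c)
    show ?case
      using mult[OF const[of c] mono[of e]] by (simp add: mult_single flip: lconst_hom(2))
  next
    case (add f g)
    thus ?case using assms(1)[OF add] by (simp only: Fract_one_hom(1) lconst_hom(1))
  qed (simp add: Fract_one_hom(4) lconst_hom zero)
  show "lconst c \<in> C" for c
  proof (cases c rule: Fract_cases_nonzero)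
    case (Fract a b)
    have "Fraction_Field.Fract b b = 1"
      using Fract(2) by (simp add: eq_fract One_fract_def)
    hence "?L b * lconst (Fraction_Field.Fract 1 b) = 1"
      by (simp add: lconst_hom(3) flip: lconst_hom(2))
    hence "lconst (Fraction_Field.Fract 1 b) \<in> C" by (rule inverse[OF poly])
    from mult[OF poly[of a] this] show ?thesis by (simp add: Fract(1) flip: lconst_hom(2))
  qed (simp add: lconst_hom zero)
  show "tvar j \<in> C" for j by (rule tvar)
  show "Poly_Mapping.single (Poly_Mapping.single j (- 1)) 1 \<in> C" for j
    using single_mult_inverse[of 1 "Poly_Mapping.single j 1"]
    by (intro inverse[OF tvar[of j]]) (simp add: tvar_def single_uminus)
qed

text \<open>Hilbert's theorem starts from the field of constants, where any nonzero element
  generates everything, and adjoins the variables and their inverses.\<close>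

lemma laurent_noetherian: "noetherian_on (UNIV :: ('k::field_char_0, 'd::{finite,linorder}) laurent set)"
proof -
  let ?K = "range lconst :: ('k, 'd) laurent set"
  have K: "subring_on ?K"
    unfolding subring_on_def
    by (auto simp flip: lconst_hom)
  have noeth: "noetherian_on ?K"
    unfolding noetherian_on_def
  proof (intro allI impI)
    fix I assume I: "ideal_on ?K I"
    show "\<exists>F. finite F \<and> F \<subseteq> I \<and> I \<subseteq> ideal_on ?K hull F"
    proof (cases "I \<subseteq> {0}")
      case True
      thus ?thesis
        using ideal_onD(2)[OF ideal_on_hull[OF K, of "{}"]] by (intro exI[of _ "{}"]) auto
    next
      case False
      then obtain x where x: "x \<in> I" "x \<noteq> 0" by auto
      then obtain c where c: "x = lconst c" using ideal_onD(1)[OF I] by auto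
      have "c \<noteq> 0" using x(2) by (auto simp: c lconst_hom)
      have "{x} \<subseteq> ?K" using c by auto
      note H = ideal_on_hull[OF K this]
      have "lconst d \<in> ideal_on ?K hull {x}" for d
      proof -
        have "lconst (d / c) * x \<in> ideal_on ?K hull {x}"
          by (intro ideal_onD(4)[OF H] hull_inc) auto
        thus ?thesis using \<open>c \<noteq> 0\<close> by (simp add: c flip: lconst_hom)
      qed
      hence "I \<subseteq> ideal_on ?K hull {x}"
        using ideal_onD(1)[OF I] by blast
      with x(1) show ?thesis by (intro exI[of _ "{x}"]) auto
    qed
  qed
  let ?T = "range tvar \<union> range (\<lambda>j. Poly_Mapping.single (Poly_Mapping.single j (- 1)) 1) :: ('k, 'd) laurent set"
  have "finite ?T" by simp
  then obtain B where B: "subring_on B" "noetherian_on B" "?K \<subseteq> B" "?T \<subseteq> B"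
    using K noeth by (rule noetherian_on_adjoin_finite)
  have "g \<in> B" for g
    by (rule laurent_generated) (use B subring_onD[OF B(1)] in auto)
  hence "B = UNIV" by auto
  with B(2) show ?thesis by simp
qed

section \<open>Fractions of polynomials in a prescribed set of variables\<close>

definition fractions :: "(nat \<Rightarrow> nat) \<Rightarrow> nat \<Rightarrow> ('d \<times> nat) set \<Rightarrow> ('k::field_char_0, 'd::{finite,linorder}) laurent set" where
  "fractions p n V = {g. \<exists>u f. u \<in> polys_in V \<and> f \<in> polys_in V \<and> tau p n u dvd 1 \<and> g * tau p n u = tau p n f}"

lemma fractionsI:
  "u \<in> polys_in V \<Longrightarrow> f \<in> polys_in V \<Longrightarrow> tau p n u dvd 1 \<Longrightarrow> g * tau p n u = tau p n f \<Longrightarrow> g \<in> fractions p n V"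
  by (auto simp: fractions_def)

lemma fractionsE:
  assumes "g \<in> fractions p n V"
  obtains u f where "u \<in> polys_in V" "f \<in> polys_in V" "tau p n u dvd 1" "g * tau p n u = tau p n f"
  using assms by (auto simp: fractions_def)

lemma polys_in_one: "1 \<in> polys_in V"
  unfolding single_one[symmetric] by (rule polys_in_single) simp

lemma tau_fraction: "f \<in> polys_in V \<Longrightarrow> tau p n f \<in> fractions p n V"
  by (rule fractionsI[OF polys_in_one]) (simp_all add: tau_hom)

lemma fractions_add:
  assumes "x \<in> fractions p n V" "y \<in> fractions p n V"
  shows "x + y \<in> fractions p n V"
proof -
  obtain u f where x: "u \<in> polys_in V" "f \<in> polys_in V" "tau p n u dvd 1" "x * tau p n u = tau p n f"
    using assms(1) by (rule fractionsE)
  obtain v g where y: "v \<in> polys_in V" "g \<in> polys_in V" "tau p n v dvd 1" "y * tau p n v = tau p n g"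
    using assms(2) by (rule fractionsE)
  have "tau p n (u * v) dvd 1"
    using mult_dvd_mono[OF x(3) y(3)] by (simp add: tau_hom)
  moreover have "(x + y) * tau p n (u * v) = (x * tau p n u) * tau p n v + (y * tau p n v) * tau p n u"
    by (simp add: tau_hom algebra_simps)
  hence "(x + y) * tau p n (u * v) = tau p n (f * v + g * u)"
    by (simp add: x y tau_hom)
  ultimately show ?thesis
    using x y by (intro fractionsI[of "u * v" V "f * v + g * u"] polys_in_mult polys_in_add)
qed

lemma fractions_mult:
  assumes "x \<in> fractions p n V" "y \<in> fractions p n V"
  shows "x * y \<in> fractions p n V"
proof -
  obtain u f where x: "u \<in> polys_in V" "f \<in> polys_in V" "tau p n u dvd 1" "x * tau p n u = tau p n f"
    using assms(1) by (rule fractionsE)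
  obtain v g where y: "v \<in> polys_in V" "g \<in> polys_in V" "tau p n v dvd 1" "y * tau p n v = tau p n g"
    using assms(2) by (rule fractionsE)
  have "tau p n (u * v) dvd 1"
    using mult_dvd_mono[OF x(3) y(3)] by (simp add: tau_hom)
  moreover have "(x * y) * tau p n (u * v) = (x * tau p n u) * (y * tau p n v)"
    by (simp add: tau_hom algebra_simps)
  hence "(x * y) * tau p n (u * v) = tau p n (f * g)"
    by (simp add: x y tau_hom)
  ultimately show ?thesis
    using x y by (intro fractionsI[of "u * v" V "f * g"] polys_in_mult)
qed

text \<open>The numerator of a unit has invertible image, so it may become the denominator.\<close>

lemma fractions_inverse:
  assumes "x \<in> fractions p n V" "x * y = 1"
  shows "y \<in> fractions p n V"
proof -
  obtain u f where x: "u \<in> polys_in V" "f \<in> polys_in V" "tau p n u dvd 1" "x * tau p n u = tau p n f"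
    using assms(1) by (rule fractionsE)
  have "x dvd 1" using assms(2) by (metis dvd_triv_left)
  hence "tau p n f dvd 1"
    using mult_dvd_mono[of x 1 "tau p n u" 1] x(3,4) by simp
  moreover have "y * tau p n f = (x * y) * tau p n u"
    by (simp add: x(4)[symmetric] algebra_simps)
  ultimately show ?thesis
    using x assms(2) by (intro fractionsI[of f V u]) auto
qed

lemma weight_single_zero:
  "l = 0 \<or> Suc m < l \<Longrightarrow> weight p (Poly_Mapping.single (j, l) c) i m = 0"
  by (induction m) (auto simp: lookup_single when_def)

lemma weight_single_last:
  "weight p (Poly_Mapping.single (j, Suc m) c) i m = (c when i = j)"
  by (cases m) (auto simp: lookup_single when_def weight_single_zero)

text \<open>This compares s_l with the \<open>p l\<close>-th power of s_{l+1}. Their quotient is an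
  \<alpha>, and accordingly the weights differ only at stage \<open>l\<close>.\<close>

lemma weight_single_Suc:
  "weight p (Poly_Mapping.single (j, Suc l) (Suc 0)) i m =
     weight p (Poly_Mapping.single (j, Suc (Suc l)) (p l)) i m + (1 when m = l \<and> i = j)"
  by (induction m) (auto simp: lookup_single when_def algebra_simps)

lemma tau_variable_dvd_one:
  "tau p n (Poly_Mapping.single e 1 :: ('k::field_char_0, 'd::{finite,linorder}) xpoly) dvd 1"
proof -
  have "Poly_Mapping.single (alpha_exponent p n e) (1 :: 'k) \<noteq> 0"
    by (metis lookup_single_eq lookup_zero zero_neq_one)
  thus ?thesis by (simp add: tau_hom single_dvd_one Fract_one_hom(3))
qed

lemma tvar_fraction:
  fixes j :: "'d::{finite,linorder}"
  assumes "(j, Suc n) \<in> V"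
  shows "(tvar j :: ('k::field_char_0, 'd) laurent) \<in> fractions p n V"
proof (rule fractionsI)
  let ?e = "Poly_Mapping.single (j, Suc n) 1"
  let ?u = "Poly_Mapping.single ?e 1 :: ('k, 'd) xpoly"
  show "?u \<in> polys_in V" using assms by (intro polys_in_single) auto
  show "1 \<in> polys_in V" by (rule polys_in_one)
  show "tau p n ?u dvd 1" by (rule tau_variable_dvd_one)
  have "tvar_exponent p n ?e = Poly_Mapping.single j (- 1)"
    by (rule poly_mapping_eqI)
      (auto simp: lookup_tvar_exponent weight_single_last lookup_single when_def)
  moreover have "alpha_exponent p n ?e = 0"
  proof (rule poly_mapping_eqI)
    fix k :: "'d \<times> nat"
    show "Poly_Mapping.lookup (alpha_exponent p n ?e) k = Poly_Mapping.lookup 0 k"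
      by (cases k) (auto simp: lookup_alpha_exponent weight_single_zero lookup_single when_def)
  qed
  ultimately show "tvar j * tau p n ?u = tau p n 1"
    by (simp add: tau_hom tvar_def mult_single Fract_one_hom(5) flip: single_add)
qed

text \<open>The eliminated \<alpha> return as quotients: \<open>alpha j (k + 1)\<close> is the
  inverse of \<open>tvar j\<close> of stage \<open>k\<close> divided by the \<open>p k\<close>-th
  power of the next inverse. This is why two neighbouring variables must belong to
  \<open>V\<close>.\<close>

lemma alpha_fraction:
  fixes j :: "'d::{finite,linorder}"
  assumes V: "(j, l) \<in> V" "(j, Suc l) \<in> V"
  shows "(lconst (alpha j l) :: ('k::field_char_0, 'd) laurent) \<in> fractions p n V"
proof -
  have tau_alpha: "tau p n (Poly_Mapping.single e 1 :: ('k, 'd) xpoly) = lconst (alpha j l)"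
    if "tvar_exponent p n e = 0" "alpha_exponent p n e = Poly_Mapping.single (j, l) 1" for e
    using that by (simp add: tau_hom lconst_def alpha_eq_single)
  have var: "(Poly_Mapping.single (Poly_Mapping.single v c) 1 :: ('k, 'd) xpoly) \<in> polys_in V" if "v \<in> V" for v c
    using that by (intro polys_in_single) auto
  consider "l = 0" | "n < l" | k where "l = Suc k" "l \<le> n"
    by (metis not_less not0_implies_Suc)
  thus ?thesis
  proof cases
    case 1
    let ?e = "Poly_Mapping.single (j, 0 :: nat) 1"
    have "tvar_exponent p n ?e = 0"
      by (rule poly_mapping_eqI) (simp add: lookup_tvar_exponent weight_single_zero)
    moreover have "alpha_exponent p n ?e = Poly_Mapping.single (j, l) 1"
    proof (rule poly_mapping_eqI)
      fix k :: "'d \<times> nat"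
      show "Poly_Mapping.lookup (alpha_exponent p n ?e) k = Poly_Mapping.lookup (Poly_Mapping.single (j, l) 1) k"
        by (cases k) (auto simp: lookup_alpha_exponent weight_single_zero lookup_single when_def 1)
    qed
    ultimately have "tau p n (Poly_Mapping.single ?e 1 :: ('k, 'd) xpoly) = lconst (alpha j l)"
      by (rule tau_alpha)
    thus ?thesis
      using tau_fraction[OF var[OF V(1)], of p n 1] 1 by simp
  next
    case 2
    let ?e = "Poly_Mapping.single (j, Suc l) 1"
    have "tvar_exponent p n ?e = 0"
      by (rule poly_mapping_eqI) (use 2 in \<open>simp add: lookup_tvar_exponent weight_single_zero\<close>)
    moreover have "alpha_exponent p n ?e = Poly_Mapping.single (j, l) 1"
    proof (rule poly_mapping_eqI)
      fix k :: "'d \<times> nat"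
      show "Poly_Mapping.lookup (alpha_exponent p n ?e) k = Poly_Mapping.lookup (Poly_Mapping.single (j, l) 1) k"
        by (cases k) (use 2 in \<open>auto simp: lookup_alpha_exponent weight_single_zero lookup_single when_def\<close>)
    qed
    ultimately show ?thesis
      using tau_fraction[OF var[OF V(2)], of p n 1] by (simp add: tau_alpha)
  next
    case 3
    let ?d = "Poly_Mapping.single (j, Suc k) (Suc 0)"
    let ?e = "Poly_Mapping.single (j, Suc (Suc k)) (p k)"
    have t: "tvar_exponent p n ?d = tvar_exponent p n ?e"
      by (rule poly_mapping_eqI) (use 3 in \<open>auto simp: lookup_tvar_exponent weight_single_Suc when_def\<close>)
    have a: "alpha_exponent p n ?d = Poly_Mapping.single (j, l) 1 + alpha_exponent p n ?e"
    proof (rule poly_mapping_eqI)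
      fix x :: "'d \<times> nat"
      obtain i m where x: "x = (i, m)" by force
      show "Poly_Mapping.lookup (alpha_exponent p n ?d) x =
          Poly_Mapping.lookup (Poly_Mapping.single (j, l) 1 + alpha_exponent p n ?e) x"
        unfolding x lookup_add lookup_alpha_exponent using 3
        by (cases m) (auto simp: weight_single_Suc lookup_single when_def)
    qed
    show ?thesis
    proof (rule fractionsI)
      show "(Poly_Mapping.single ?e 1 :: ('k, 'd) xpoly) \<in> polys_in V"
        "(Poly_Mapping.single ?d 1 :: ('k, 'd) xpoly) \<in> polys_in V"
        using V 3(1) by (simp_all add: var)
      show "tau p n (Poly_Mapping.single ?e 1 :: ('k, 'd) xpoly) dvd 1"
        by (rule tau_variable_dvd_one)
      show "lconst (alpha j l) * tau p n (Poly_Mapping.single ?e 1) = tau p n (Poly_Mapping.single ?d (1::'k))"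
        by (simp add: tau_hom t a lconst_def alpha_eq_single mult_single)
    qed
  qed
qed

lemma const_fraction:
  "lconst (Fraction_Field.Fract (Poly_Mapping.single 0 c) 1) \<in> fractions p n V"
  using tau_fraction[of "Poly_Mapping.single 0 c" V p n]
  by (simp add: polys_in_single tau_hom tvar_exponent_zero alpha_exponent_zero lconst_def)

text \<open>Together with \<open>inj_tau\<close> this exhibits stage \<open>n\<close> as a
  localization of the polynomial ring.\<close>

lemma fractions_UNIV: "g \<in> fractions p n UNIV"
  by (rule laurent_generated_with_inverses)
    (auto intro: fractions_add fractions_mult fractions_inverse const_fraction alpha_fraction tvar_fraction)

section \<open>Polynomials and fractions carried along the stages\<close>

lemma phi_one: "phi p n 1 = 1"
  using phi_lconst[of p n 1] by (simp add: lconst_hom(3))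

interpretation phi: direct_system "phi p :: nat \<Rightarrow> ('k::field_char_0, 'd::{finite,linorder}) laurent \<Rightarrow> _"
  by standard (rule phi_add phi_mult phi_one)+

lemma transition_dvd_one: "x dvd 1 \<Longrightarrow> transition (phi p) n a x dvd 1"
  by (metis dvdE dvd_triv_left phi.transition_hom(2,3))

lemma early_variables_mono: "m \<le> n \<Longrightarrow> early_variables m \<subseteq> early_variables n"
  by (auto simp: early_variables_def)

lemma transition_tau:
  "f \<in> polys_in (early_variables m) \<Longrightarrow> transition (phi p) m a (tau p m f) = tau p (m + a) f"
proof (induction a)
  case (Suc a)
  have "f \<in> polys_in (early_variables (m + a))"
    using Suc.prems polys_in_mono[OF early_variables_mono[of m "m + a"]] by auto
  with Suc show ?case by (simp add: phi_tau)
qed simp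

lemma phi_fraction:
  assumes "g \<in> fractions p n (early_variables n)"
  shows "phi p n g \<in> fractions p (Suc n) (early_variables (Suc n))"
proof -
  let ?V = "early_variables n" and ?W = "early_variables (Suc n)"
  obtain u f where uf: "u \<in> polys_in ?V" "f \<in> polys_in ?V" "tau p n u dvd 1" "g * tau p n u = tau p n f"
    using assms by (rule fractionsE)
  have "polys_in ?V \<subseteq> polys_in ?W"
    by (intro polys_in_mono early_variables_mono) simp
  moreover have "tau p (Suc n) u dvd 1"
    using transition_dvd_one[OF uf(3), of p n 1] by (simp add: phi_tau[OF uf(1)])
  moreover have "phi p n g * tau p (Suc n) u = tau p (Suc n) f"
  proof -
    have "phi p n (g * tau p n u) = phi p n (tau p n f)" by (simp only: uf(4))
    thus ?thesis by (simp only: phi_mult phi_tau[OF uf(1)] phi_tau[OF uf(2)])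
  qed
  ultimately show ?thesis using uf(1,2) by (intro fractionsI[of u _ f]) auto
qed

text \<open>A coefficient of \<open>g\<close> may involve any \<open>alpha j l\<close>, and this is
  a fraction in early variables from stage \<open>l\<close> on. A fraction found at stage 0 cannot
  simply be transported, since its later variables change their interpretation; so the claim is
  checked on generators.\<close>

lemma eventually_fraction:
  fixes g :: "('k::field_char_0, 'd::{finite,linorder}) laurent"
  shows "\<exists>M. \<forall>n\<ge>M. transition (phi p) 0 n g \<in> fractions p n (early_variables n)"
proof -
  let ?C = "{g. \<exists>M. \<forall>n\<ge>M. transition (phi p) 0 n g \<in> fractions p n (early_variables n)}
    :: ('k, 'd) laurent set"
  have trans_lconst: "transition (phi p) 0 n (lconst c) = lconst c" for n and c :: "('k, 'd) ratfun"
    by (induction n) (simp_all add: phi_lconst)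
  have "g \<in> ?C"
  proof (rule laurent_generated_with_inverses)
    show "x + y \<in> ?C" "x * y \<in> ?C" if xy: "x \<in> ?C" "y \<in> ?C" for x y
    proof -
      obtain M N where "\<forall>n\<ge>M. transition (phi p) 0 n x \<in> fractions p n (early_variables n)"
        "\<forall>n\<ge>N. transition (phi p) 0 n y \<in> fractions p n (early_variables n)"
        using xy by blast
      hence "\<forall>n\<ge>max M N. transition (phi p) 0 n (x + y) \<in> fractions p n (early_variables n)"
        "\<forall>n\<ge>max M N. transition (phi p) 0 n (x * y) \<in> fractions p n (early_variables n)"
        by (simp_all add: phi.transition_hom fractions_add fractions_mult)
      thus "x + y \<in> ?C" "x * y \<in> ?C" by blast+
    qed
    show "y \<in> ?C" if x: "x \<in> ?C" and xy: "x * y = 1" for x y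
    proof -
      obtain M where "\<forall>n\<ge>M. transition (phi p) 0 n x \<in> fractions p n (early_variables n)"
        using x by blast
      moreover have "transition (phi p) 0 n x * transition (phi p) 0 n y = 1" for n
        using arg_cong[OF xy, of "transition (phi p) 0 n"] by (simp add: phi.transition_hom)
      ultimately have "\<forall>n\<ge>M. transition (phi p) 0 n y \<in> fractions p n (early_variables n)"
        using fractions_inverse by blast
      thus ?thesis by blast
    qed
    show "lconst (Fraction_Field.Fract (Poly_Mapping.single 0 c) 1) \<in> ?C" for c
      by (simp add: trans_lconst const_fraction)
    show "lconst (alpha j l) \<in> ?C" for j l
      unfolding mem_Collect_eq trans_lconst
      by (intro exI[of _ l] allI impI alpha_fraction) (auto simp: early_variables_def)
    show "tvar j \<in> ?C" for j
    proof -
      have "transition (phi p) 0 n (tvar j :: ('k, 'd) laurent) \<in> fractions p n (early_variables n)" for n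
      proof (induction n)
        case 0
        show ?case by (simp add: tvar_fraction early_variables_def)
      next
        case (Suc n)
        thus ?case by (simp add: phi_fraction)
      qed
      thus ?thesis by simp
    qed
  qed
  thus ?thesis by simp
qed

text \<open>Division of the exponents by \<open>p n\<close> with remainder: the finitely many
  monomials with all exponents in [0, p n) generate.\<close>

lemma phi_spanning_set:
  assumes "p n > 0"
  obtains S :: "('k::field_char_0, 'd::{finite,linorder}) laurent set"
  where "finite S" "\<And>x. \<exists>c. x = (\<Sum>s\<in>S. phi p n (c s) * s)"
proof -
  let ?R = "{r :: 'd \<Rightarrow>\<^sub>0 int. \<forall>j. Poly_Mapping.lookup r j \<in> {0..<int (p n)}}"
  let ?S = "(\<lambda>r. Poly_Mapping.single r 1) ` ?R :: ('k, 'd) laurent set"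
  have "Poly_Mapping.lookup ` ?R \<subseteq> PiE UNIV (\<lambda>_. {0..<int (p n)})"
    by auto
  hence "finite (Poly_Mapping.lookup ` ?R)"
    by (rule finite_subset) (simp add: finite_PiE)
  hence "finite ?R"
    by (rule finite_imageD) (rule inj_onI, simp only: poly_mapping.lookup_inject)
  hence fin: "finite ?S" by simp
  have "\<exists>c. x = (\<Sum>s\<in>?S. phi p n (c s) * s)" for x
  proof (induction x rule: poly_mapping_add_induct)
    case zero
    show ?case by (intro exI[of _ "\<lambda>_. 0"]) (simp add: phi_zero)
  next
    case (single e a)
    define q where "q = Poly_Mapping.Abs_poly_mapping (\<lambda>j. Poly_Mapping.lookup e j div int (p n))"
    define r where "r = Poly_Mapping.Abs_poly_mapping (\<lambda>j. Poly_Mapping.lookup e j mod int (p n))"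
    \<comment> \<open>The scalar that \<open>phi\<close> attaches to the monomial with exponent
      \<open>q\<close>. It is divided out in advance, which works because \<open>phi\<close> leaves
      scalars unchanged.\<close>
    define u :: "('k, 'd) ratfun" where "u = (\<Prod>j\<in>UNIV. alpha j (Suc n) powi (- Poly_Mapping.lookup q j))"
    have "u \<noteq> 0" by (simp add: u_def alpha_nonzero)
    have "Poly_Mapping.map (\<lambda>a. int (p n) * a) q + r = e"
      by (rule poly_mapping_eqI) (simp add: lookup_add lookup_scale q_def r_def)
    hence eq: "Poly_Mapping.single e a = phi p n (Poly_Mapping.single q (a / u)) * Poly_Mapping.single r 1"
      using \<open>u \<noteq> 0\<close> by (simp add: phi_single mult_single flip: u_def)
    have mem: "(Poly_Mapping.single r 1 :: ('k, 'd) laurent) \<in> ?S"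
      using assms by (auto simp: r_def)
    define c where "c s = (if s = Poly_Mapping.single r 1 then Poly_Mapping.single q (a / u) else 0)"
      for s :: "('k, 'd) laurent"
    have "(\<Sum>s\<in>?S. phi p n (c s) * s) = (\<Sum>s\<in>?S. if s = Poly_Mapping.single r 1 then phi p n (Poly_Mapping.single q (a / u)) * s else 0)"
      by (rule sum.cong) (auto simp: c_def phi_zero)
    also have "\<dots> = Poly_Mapping.single e a"
      using fin mem by (simp add: eq)
    finally show ?case by (intro exI[of _ c]) (rule sym)
  next
    case (add f g)
    obtain c where c: "f = (\<Sum>s\<in>?S. phi p n (c s) * s)"
      using add(1) by (rule exE)
    obtain d where d: "g = (\<Sum>s\<in>?S. phi p n (d s) * s)"
      using add(2) by (rule exE)
    have "f + g = (\<Sum>s\<in>?S. phi p n (c s + d s) * s)"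
      unfolding phi_add distrib_right sum.distrib c[symmetric] d[symmetric] ..
    thus ?case by (rule exI[where x = "\<lambda>s. c s + d s"])
  qed
  with fin show ?thesis by (rule that)
qed

text \<open>Only contractions to stage 0 are compared. Peeling off the last transition map, the
  induction hypothesis identifies the contractions to the stage before, and then one application of
  \<open>incomparability\<close> is enough.\<close>

lemma incomparability_stage:
  fixes P Q :: "('k::field_char_0, 'd::{finite,linorder}) laurent set"
  assumes p: "\<And>n. p n > 0"
    and "prime_on P" "prime_on Q" "Q \<subseteq> P" "transition (phi p) 0 n -` P \<subseteq> transition (phi p) 0 n -` Q"
  shows "P = Q"
  using assms(2-)
proof (induction n arbitrary: P Q)
  case 0
  thus ?case by (auto simp: vimage_def)
next
  case (Suc n)
  note vim = prime_on_vimage[of "phi p n", OF phi_add phi_mult phi_one]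
  have "phi p n -` P = phi p n -` Q"
  proof (rule Suc.IH)
    show "prime_on (phi p n -` P)" "prime_on (phi p n -` Q)"
      using Suc.prems(1,2) by (simp_all add: vim)
    show "transition (phi p) 0 n -` phi p n -` P \<subseteq> transition (phi p) 0 n -` phi p n -` Q"
      using Suc.prems(4) by auto
  qed (use Suc.prems(3) in auto)
  moreover obtain S :: "('k, 'd) laurent set"
    where "finite S" "\<And>x. \<exists>c. x = (\<Sum>s\<in>S. phi p n (c s) * s)"
    using phi_spanning_set[of p n, OF p] by blast
  ultimately show ?case
    using Suc.prems by (intro incomparability[of "phi p n" S P Q]) (simp_all add: phi_add phi_mult phi_one)
qed

theorem noetherian_R_kd:
  assumes p: "\<And>n. p n > 0"
  shows "noetherian_ring (R_kd p :: (nat \<times> ('k::field_char_0, 'd::{finite,linorder}) laurent) set ring)"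
  unfolding R_kd_def
proof (rule phi.noetherian_dirlim)
  fix P :: "nat \<Rightarrow> ('k, 'd) laurent set"
  assume prime: "\<And>n. prime_on (P n)" and compat: "\<And>n. phi p n -` P (Suc n) = P n"
  let ?tr = "transition (phi p :: nat \<Rightarrow> ('k, 'd) laurent \<Rightarrow> _)"
  have trans_iff: "?tr m a x \<in> P (m + a) \<longleftrightarrow> x \<in> P m" for m a x
    by (induction a) (use compat in auto)
  have fg: "\<exists>F. finite F \<and> F \<subseteq> P n \<and> P n \<subseteq> ideal_on UNIV hull F" for n
    using laurent_noetherian prime_onD(1)[OF prime] by (auto simp: noetherian_on_def)
  obtain G where G: "finite G" "G \<subseteq> P 0" "P 0 \<subseteq> ideal_on UNIV hull G"
    using fg by blast
  have "\<exists>M. \<forall>g\<in>G. ?tr 0 M g \<in> fractions p M (early_variables M)"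
  proof -
    have "\<forall>g. \<exists>N. \<forall>n\<ge>N. ?tr 0 n g \<in> fractions p n (early_variables n)"
      using eventually_fraction by blast
    then obtain N where N: "\<And>g n. N g \<le> n \<Longrightarrow> ?tr 0 n g \<in> fractions p n (early_variables n)"
      by metis
    have "N g \<le> Max (N ` G)" if "g \<in> G" for g
      using G(1) that by simp
    with N show ?thesis by blast
  qed
  then obtain M where M: "\<And>g. g \<in> G \<Longrightarrow> ?tr 0 M g \<in> fractions p M (early_variables M)"
    by blast
  \<comment> \<open>The single prime \<open>J\<close> generated by \<open>J0\<close> serves all
    stages from \<open>M\<close> on: early polynomials keep their interpretation there, so
    \<open>Q n\<close> is the extension of the same \<open>J\<close> along
    \<open>tau p (M + n)\<close>.\<close>
  define J0 where "J0 = (tau p M -` P M) \<inter> polys_in (early_variables M)"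
  define J where "J = ideal_on UNIV hull J0"
  define Q where "Q n = ideal_on UNIV hull (tau p (M + n) ` J)" for n
  have QI: "ideal_on UNIV (Q n)" for n
    by (simp add: Q_def ideal_on_UNIV_hull)
  have J: "prime_on J"
    unfolding J_def J0_def
    by (intro prime_on_extension prime_on_vimage prime) (simp_all add: tau_hom)
  have J_minimal: "tau p (M + n) ` J \<subseteq> I" if "ideal_on UNIV I" "tau p (M + n) ` J0 \<subseteq> I" for n I
  proof -
    have "J \<subseteq> tau p (M + n) -` I"
      unfolding J_def using that by (intro hull_minimal ideal_on_vimage) (auto simp: tau_hom)
    thus ?thesis by blast
  qed
  have tau_J0: "tau p (M + n) f = ?tr M n (tau p M f)" if "f \<in> J0" for f n
    using that by (simp add: J0_def transition_tau)
  have J_P: "tau p (M + n) ` J \<subseteq> P (M + n)" for n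
    using prime_onD(1)[OF prime] by (rule J_minimal) (auto simp: tau_J0 trans_iff, simp add: J0_def)
  have Q_prime: "prime_on (Q n)" for n
    unfolding Q_def
  proof (rule prime_on_localization[OF _ _ _ inj_tau _ J])
    show "\<exists>u f. tau p (M + n) u dvd 1 \<and> g * tau p (M + n) u = tau p (M + n) f" for g :: "('k, 'd) laurent"
      using fractions_UNIV[of g p "M + n"] by (auto simp: fractions_def)
    \<comment> \<open>A unit in the image of \<open>J\<close> would belong to the prime
      \<open>P (M + n)\<close>.\<close>
    show "\<not> tau p (M + n) u dvd 1" if "u \<in> J" for u
      using J_P that prime_on_not_unit[OF prime] by blast
  qed (simp_all add: tau_hom)
  have QP: "Q n \<subseteq> P (M + n)" for n
    unfolding Q_def using J_P prime_onD(1)[OF prime] by (rule hull_minimal)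
  have PQ: "P (M + n) = Q n" for n
  proof (rule incomparability_stage[OF p prime Q_prime QP])
    \<comment> \<open>By the choice of \<open>M\<close>, \<open>g\<close> is a fraction of early
      polynomials. Its numerator lies in \<open>J\<close> because \<open>g\<close> lies in
      \<open>P\<close>, and its denominator remains a unit at stage \<open>M + n\<close>.\<close>
    have "G \<subseteq> ?tr 0 (M + n) -` Q n"
    proof
      fix g assume g: "g \<in> G"
      obtain u f where uf: "u \<in> polys_in (early_variables M)" "f \<in> polys_in (early_variables M)"
        "tau p M u dvd 1" "?tr 0 M g * tau p M u = tau p M f"
        using M[OF g] by (rule fractionsE)
      have "?tr 0 M g \<in> P M"
        using trans_iff[of 0 M g] g G(2) by auto
      hence "tau p M f \<in> P M"
        unfolding uf(4)[symmetric] using ideal_onD(5)[OF prime_onD(1)[OF prime]] by blast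
      hence "f \<in> J"
        using uf(2) by (auto simp: J_def J0_def intro: hull_inc)
      hence fQ: "tau p (M + n) f \<in> Q n"
        unfolding Q_def by (intro hull_inc imageI)
      have eq: "?tr 0 (M + n) g * tau p (M + n) u = tau p (M + n) f"
        using arg_cong[OF uf(4), of "?tr M n"]
        by (simp add: phi.transition_hom transition_tau uf(1,2) transition_add)
      obtain v where v: "1 = tau p (M + n) u * v"
        using transition_dvd_one[OF uf(3), of p M n] by (auto simp: transition_tau uf(1) elim: dvdE)
      have "?tr 0 (M + n) g = tau p (M + n) f * v"
        by (simp only: eq[symmetric] mult.assoc v[symmetric] mult_1_right)
      thus "g \<in> ?tr 0 (M + n) -` Q n"
        using ideal_onD(5)[OF QI UNIV_I fQ] by simp
    qed
    hence "ideal_on UNIV hull G \<subseteq> ?tr 0 (M + n) -` Q n"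
      by (rule hull_minimal) (intro ideal_on_vimage phi.transition_hom QI)
    moreover have "?tr 0 (M + n) -` P (M + n) = P 0"
      using trans_iff[of 0 "M + n"] by auto
    ultimately show "?tr 0 (M + n) -` P (M + n) \<subseteq> ?tr 0 (M + n) -` Q n"
      using G(3) by simp
  qed
  obtain F where F: "finite F" "F \<subseteq> P M" "P M \<subseteq> ideal_on UNIV hull F"
    using fg by blast
  have "P (M + n) \<subseteq> ideal_on UNIV hull (?tr M n ` F)" for n
  proof -
    let ?H = "ideal_on UNIV hull (?tr M n ` F)"
    have "ideal_on UNIV hull F \<subseteq> ?tr M n -` ?H"
      by (rule hull_minimal) (auto intro: hull_inc intro!: ideal_on_vimage phi.transition_hom ideal_on_UNIV_hull)
    \<comment> \<open>At stage \<open>M\<close> the image of \<open>J0\<close> lies in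
      \<open>P M\<close>, hence in the span of \<open>F\<close>; transporting this bounds the
      generators of \<open>Q n\<close>, which by \<open>PQ\<close> is the whole of
      \<open>P (M + n)\<close>.\<close>
    hence "tau p (M + n) ` J0 \<subseteq> ?H"
      using F(3) by (auto simp: tau_J0, auto simp: J0_def)
    hence "tau p (M + n) ` J \<subseteq> ?H"
      by (intro J_minimal ideal_on_UNIV_hull)
    thus ?thesis
      unfolding PQ Q_def by (intro hull_minimal ideal_on_UNIV_hull)
  qed
  with F(1,2) show "\<exists>M F. finite F \<and> F \<subseteq> P M \<and> (\<forall>n. P (M + n) \<subseteq> ideal_on UNIV hull (?tr M n ` F))"
    by blast
qed

section \<open>The grading\<close>

lemma scale_exponent_inject:
  assumes "c \<noteq> 0" "Poly_Mapping.map (\<lambda>a. c * a) d = Poly_Mapping.map (\<lambda>a. c * a) e"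
  shows "d = (e :: 'd \<Rightarrow>\<^sub>0 int)"
proof (rule poly_mapping_eqI)
  fix j
  show "Poly_Mapping.lookup d j = Poly_Mapping.lookup e j"
    using arg_cong[OF assms(2), of "\<lambda>f. Poly_Mapping.lookup f j"] assms(1) by (simp add: lookup_scale)
qed

text \<open>Scaling exponents by \<open>p n > 0\<close> is injective, so each term of the image
  comes from a single term of \<open>f\<close>.\<close>

lemma lookup_phi:
  assumes "p n > 0"
  shows "Poly_Mapping.lookup (phi p n f) (Poly_Mapping.map (\<lambda>a. int (p n) * a) e) =
    Poly_Mapping.lookup f e * (\<Prod>j\<in>UNIV. alpha j (Suc n) powi (- Poly_Mapping.lookup e j))"
proof -
  let ?c = "\<lambda>d. Poly_Mapping.lookup f d * (\<Prod>j\<in>UNIV. alpha j (Suc n) powi (- Poly_Mapping.lookup d j))"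
  have "Poly_Mapping.lookup (phi p n f) (Poly_Mapping.map (\<lambda>a. int (p n) * a) e) =
      (\<Sum>d\<in>Poly_Mapping.keys f. if d = e then ?c d else 0)"
    unfolding phi_def lookup_sum
    by (rule sum.cong) (use assms in \<open>auto simp: lookup_single when_def dest: scale_exponent_inject[rotated]\<close>)
  also have "\<dots> = ?c e"
    by (simp add: in_keys_iff)
  finally show ?thesis .
qed

lemma inj_phi:
  fixes p :: "nat \<Rightarrow> nat"
  assumes "p n > 0"
  shows "inj (phi p n :: ('k::field_char_0, 'd::{finite,linorder}) laurent \<Rightarrow> _)"
proof (rule injI, rule poly_mapping_eqI)
  fix f g :: "('k, 'd) laurent" and e
  assume "phi p n f = phi p n g"
  hence "Poly_Mapping.lookup f e * (\<Prod>j\<in>UNIV. alpha j (Suc n) powi (- Poly_Mapping.lookup e j)) =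
      Poly_Mapping.lookup g e * (\<Prod>j\<in>UNIV. alpha j (Suc n) powi (- Poly_Mapping.lookup e j))"
    by (simp only: lookup_phi[of p n, OF assms, symmetric])
  thus "Poly_Mapping.lookup f e = Poly_Mapping.lookup g e"
    by (simp add: alpha_nonzero)
qed

lemma monomial_degree_add: "monomial_degree p n (d + e) = monomial_degree p n d + monomial_degree p n e"
  by (simp add: monomial_degree_def vec_eq_iff lookup_add add_divide_distrib)

text \<open>At a fixed stage the degree is the exponent divided by a nonzero constant. Hence a
  nonzero homogeneous element has only one term, which makes it invertible.\<close>

lemma monomial_degree_inject:
  assumes "\<And>n. p n > 0" "monomial_degree p n d = monomial_degree p n e"
  shows "d = e"
proof (rule poly_mapping_eqI)
  fix j
  have nz: "p m \<noteq> 0" for m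
    using assms(1)[of m] by simp
  show "Poly_Mapping.lookup d j = Poly_Mapping.lookup e j"
    using arg_cong[OF assms(2), of "\<lambda>v. v $ j"] by (simp add: monomial_degree_def nz)
qed

lemma stage_component_closed:
  "0 \<in> stage_component p n g"
  "x \<in> stage_component p n g \<Longrightarrow> y \<in> stage_component p n g \<Longrightarrow> x + y \<in> stage_component p n g"
  "x \<in> stage_component p n g \<Longrightarrow> - x \<in> stage_component p n g"
  using Poly_Mapping.keys_add[of x y] by (auto simp: stage_component_def in_keys_iff)

lemma stage_component_mult:
  assumes "x \<in> stage_component p n g" "y \<in> stage_component p n h"
  shows "x * y \<in> stage_component p n (g + h)"
proof -
  have "monomial_degree p n e = g + h" if e: "e \<in> Poly_Mapping.keys (x * y)" for e
  proof -
    obtain a b where "e = a + b" "a \<in> Poly_Mapping.keys x" "b \<in> Poly_Mapping.keys y"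
      using e Poly_Mapping.keys_mult[of x y] by blast
    thus ?thesis using assms by (simp add: stage_component_def monomial_degree_add)
  qed
  thus ?thesis by (simp add: stage_component_def)
qed

definition degree_part :: "(nat \<Rightarrow> nat) \<Rightarrow> nat \<Rightarrow> rat^('d::{finite,linorder}) \<Rightarrow>
    ('k::field_char_0, 'd) laurent \<Rightarrow> ('k, 'd) laurent" where
  "degree_part p n g f = (\<Sum>e\<in>{e \<in> Poly_Mapping.keys f. monomial_degree p n e = g}.
     Poly_Mapping.single e (Poly_Mapping.lookup f e))"

lemma lookup_degree_part:
  "Poly_Mapping.lookup (degree_part p n g f) e = (Poly_Mapping.lookup f e when monomial_degree p n e = g)"
proof -
  have "Poly_Mapping.lookup (degree_part p n g f) e =
      (\<Sum>d\<in>{d \<in> Poly_Mapping.keys f. monomial_degree p n d = g}. if d = e then Poly_Mapping.lookup f d else 0)"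
    unfolding degree_part_def lookup_sum by (rule sum.cong) (auto simp: lookup_single when_def)
  also have "\<dots> = (Poly_Mapping.lookup f e when monomial_degree p n e = g)"
    by (auto simp: in_keys_iff when_def)
  finally show ?thesis .
qed

lemma degree_part_in: "degree_part p n g f \<in> stage_component p n g"
  by (auto simp: stage_component_def in_keys_iff lookup_degree_part)

lemma sum_degree_part:
  "f = (\<Sum>g\<in>monomial_degree p n ` Poly_Mapping.keys f. degree_part p n g f)"
  unfolding degree_part_def
  by (subst sum.image_gen[OF finite_keys, symmetric]) (rule sum_single_lookup[symmetric])

lemma degree_part_sum:
  assumes "finite S" "\<And>g. g \<in> S \<Longrightarrow> k g \<in> stage_component p n g"
  shows "degree_part p n g (sum k S) = (if g \<in> S then k g else 0)"
proof (rule poly_mapping_eqI)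
  fix e
  have zero: "Poly_Mapping.lookup (k h) e = 0" if "h \<in> S" "monomial_degree p n e \<noteq> h" for h
  proof -
    have "e \<notin> Poly_Mapping.keys (k h)"
      using assms(2)[OF that(1)] that(2) by (auto simp: stage_component_def)
    thus ?thesis by (simp add: in_keys_iff)
  qed
  have "Poly_Mapping.lookup (sum k S) e = (\<Sum>h\<in>S. if h = monomial_degree p n e then Poly_Mapping.lookup (k h) e else 0)"
    unfolding lookup_sum by (rule sum.cong) (auto simp: zero)
  hence sum: "Poly_Mapping.lookup (sum k S) e =
      (if monomial_degree p n e \<in> S then Poly_Mapping.lookup (k (monomial_degree p n e)) e else 0)"
    using assms(1) by simp
  show "Poly_Mapping.lookup (degree_part p n g (sum k S)) e = Poly_Mapping.lookup (if g \<in> S then k g else 0) e"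
    using zero[of g] by (auto simp: lookup_degree_part sum when_def)
qed

lemma transition_stage_component:
  assumes "\<And>n. p n > 0" "f \<in> stage_component p n g"
  shows "transition (phi p) n a f \<in> stage_component p (n + a) g"
  using assms(2) by (induction a) (use assms(1) in \<open>auto intro!: phi_stage_component simp: neq0_conv\<close>)

section \<open>The limit as a graded field\<close>

locale R_kd_ring =
  fixes p :: "nat \<Rightarrow> nat" and type_k :: "'k::field_char_0 itself" and type_d :: "'d::{finite,linorder} itself"
  assumes p_pos: "p n > 0"
begin

abbreviation cls :: "nat \<Rightarrow> ('k, 'd) laurent \<Rightarrow> (nat \<times> ('k, 'd) laurent) set" where
  "cls \<equiv> dirlim_class (phi p)"

abbreviation R :: "(nat \<times> ('k, 'd) laurent) set ring" where
  "R \<equiv> R_kd p"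

abbreviation component :: "rat^('d::{finite,linorder}) \<Rightarrow> (nat \<times> ('k, 'd) laurent) set set" where
  "component \<equiv> R_kd_component p"

sublocale cring R
  unfolding R_kd_def by (rule phi.is_cring)

lemmas cls_hom = phi.class_add[of p, folded R_kd_def] phi.class_mult[of p, folded R_kd_def]
  phi.class_one[of p, folded R_kd_def] phi.class_zero[of p, folded R_kd_def]

lemma cls_carrier [simp, intro]: "cls n f \<in> carrier R"
  by (simp add: R_kd_def phi.class_in_carrier)

text \<open>The transition maps are injective, so every stage embeds into the limit and equations
  between classes can be compared at one stage.\<close>

lemma cls_inject: "cls n f = cls n g \<Longrightarrow> f = g"
proof -
  assume "cls n f = cls n g"
  then obtain a where "transition (phi p) n a f = transition (phi p) n a g"
    by (auto simp: phi.class_eq_iff)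
  thus "f = g"
    by (induction a) (auto dest: injD[OF inj_phi[of p, OF p_pos]])
qed

lemma cls_minus: "\<ominus>\<^bsub>R\<^esub> cls n f = cls n (- f)"
  by (rule minus_equality) (simp_all add: cls_hom)

lemma finsum_cls: "finite S \<Longrightarrow> (\<Oplus>\<^bsub>R\<^esub>g\<in>S. cls n (k g)) = cls n (sum k S)"
  by (induction S rule: finite_induct) (simp_all add: cls_hom)

lemma component_stage:
  assumes "x \<in> component g"
  obtains N where "\<And>n. N \<le> n \<Longrightarrow> \<exists>f \<in> stage_component p n g. x = cls n f"
proof -
  obtain N f where f: "f \<in> stage_component p N g" "x = cls N f"
    using assms by (auto simp: R_kd_component_def)
  have "\<exists>f \<in> stage_component p n g. x = cls n f" if "N \<le> n" for n
    using phi.class_transition[of p N "n - N" f] transition_stage_component[of p f N g "n - N", OF p_pos f(1)] that f(2)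
    by (intro bexI[of _ "transition (phi p) N (n - N) f"]) auto
  thus ?thesis by (rule that)
qed

lemma component_carrier: "component g \<subseteq> carrier R"
  by (auto simp: R_kd_component_def)

lemma cls_in_component: "f \<in> stage_component p n g \<Longrightarrow> cls n f \<in> component g"
  by (auto simp: R_kd_component_def)

lemma component_stage2:
  assumes "x \<in> component g" "y \<in> component h"
  obtains n a b where "a \<in> stage_component p n g" "x = cls n a" "b \<in> stage_component p n h" "y = cls n b"
proof -
  obtain N where N: "\<And>n. N \<le> n \<Longrightarrow> \<exists>f \<in> stage_component p n g. x = cls n f"
    using assms(1) by (rule component_stage) blast
  obtain M where M: "\<And>n. M \<le> n \<Longrightarrow> \<exists>f \<in> stage_component p n h. y = cls n f"
    using assms(2) by (rule component_stage) blast
  from N[of "N + M"] M[of "N + M"] show ?thesis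
    by (auto intro: that)
qed

lemma component_family_stage:
  assumes "finite S" "\<And>g. g \<in> S \<Longrightarrow> u g \<in> component g"
  shows "\<exists>N. \<forall>n\<ge>N. \<exists>k. \<forall>g\<in>S. k g \<in> stage_component p n g \<and> u g = cls n (k g)"
proof -
  have "\<forall>g\<in>S. \<exists>N. \<forall>n\<ge>N. \<exists>f. f \<in> stage_component p n g \<and> u g = cls n f"
  proof
    fix g assume "g \<in> S"
    hence "u g \<in> component g" by (rule assms(2))
    then obtain N where "\<And>n. N \<le> n \<Longrightarrow> \<exists>f \<in> stage_component p n g. u g = cls n f"
      by (rule component_stage) blast
    thus "\<exists>N. \<forall>n\<ge>N. \<exists>f. f \<in> stage_component p n g \<and> u g = cls n f" by blast
  qed
  then obtain N where N: "\<forall>g\<in>S. \<forall>n\<ge>N g. \<exists>f. f \<in> stage_component p n g \<and> u g = cls n f"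
    by (rule bchoice[THEN exE])
  \<comment> \<open>For empty \<open>S\<close> the maximum is unspecified, but then nothing is
    claimed about any \<open>g\<close>.\<close>
  show ?thesis
  proof (intro exI[of _ "Max (N ` S)"] allI impI)
    fix n assume n: "Max (N ` S) \<le> n"
    have "\<forall>g\<in>S. \<exists>f. f \<in> stage_component p n g \<and> u g = cls n f"
    proof
      fix g assume g: "g \<in> S"
      have "N g \<le> Max (N ` S)" using assms(1) g by simp
      with n have "N g \<le> n" by simp
      with N g show "\<exists>f. f \<in> stage_component p n g \<and> u g = cls n f" by blast
    qed
    thus "\<exists>k. \<forall>g\<in>S. k g \<in> stage_component p n g \<and> u g = cls n (k g)"
      by (rule bchoice)
  qed
qed

text \<open>At a common stage, a homogeneous family is recovered from a representative of its sum by
  taking degree parts. This is what gives uniqueness of decompositions.\<close>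

lemma decomposition_stage:
  assumes fin: "finite {g. u g \<noteq> \<zero>\<^bsub>R\<^esub>}" and u: "\<And>g. u g \<in> component g"
  shows "\<exists>N. \<forall>n\<ge>N. \<exists>f. (\<Oplus>\<^bsub>R\<^esub>g\<in>{g. u g \<noteq> \<zero>\<^bsub>R\<^esub>}. u g) = cls n f \<and> (\<forall>g. u g = cls n (degree_part p n g f))"
proof -
  let ?S = "{g. u g \<noteq> \<zero>\<^bsub>R\<^esub>}"
  obtain N where N: "\<And>n. N \<le> n \<Longrightarrow> \<exists>k. \<forall>g\<in>?S. k g \<in> stage_component p n g \<and> u g = cls n (k g)"
    using component_family_stage[OF fin u] by blast
  have "\<exists>f. (\<Oplus>\<^bsub>R\<^esub>g\<in>?S. u g) = cls n f \<and> (\<forall>g. u g = cls n (degree_part p n g f))" if n: "N \<le> n" for n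
  proof -
    obtain k where k: "\<And>g. g \<in> ?S \<Longrightarrow> k g \<in> stage_component p n g" "\<And>g. g \<in> ?S \<Longrightarrow> u g = cls n (k g)"
      using N[OF n] by blast
    have "(\<Oplus>\<^bsub>R\<^esub>g\<in>?S. u g) = (\<Oplus>\<^bsub>R\<^esub>g\<in>?S. cls n (k g))"
      using k(2) by (intro finsum_cong') auto
    also have "\<dots> = cls n (sum k ?S)"
      by (rule finsum_cls[OF fin])
    finally have sum: "(\<Oplus>\<^bsub>R\<^esub>g\<in>?S. u g) = cls n (sum k ?S)" .
    have "u g = cls n (degree_part p n g (sum k ?S))" for g
    proof -
      have "degree_part p n g (sum k ?S) = (if g \<in> ?S then k g else 0)"
        using fin k(1) by (rule degree_part_sum)
      thus ?thesis using k(2)[of g] by (auto simp: cls_hom)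
    qed
    with sum show ?thesis by blast
  qed
  thus ?thesis by blast
qed

lemma decomposition_exists:
  assumes "x \<in> carrier R"
  shows "\<exists>u. finite {g. u g \<noteq> \<zero>\<^bsub>R\<^esub>} \<and> (\<forall>g. u g \<in> component g) \<and> x = (\<Oplus>\<^bsub>R\<^esub>g\<in>{g. u g \<noteq> \<zero>\<^bsub>R\<^esub>}. u g)"
proof -
  obtain n f where x: "x = cls n f"
    using assms unfolding R_kd_def by (rule phi.carrier_stageE)
  let ?k = "\<lambda>g. degree_part p n g f"
  let ?S = "{g. cls n (?k g) \<noteq> \<zero>\<^bsub>R\<^esub>}"
  have sub: "?S \<subseteq> monomial_degree p n ` Poly_Mapping.keys f"
  proof
    fix g assume g: "g \<in> ?S"
    hence "?k g \<noteq> 0" by (auto simp: cls_hom)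
    then obtain e where "Poly_Mapping.lookup (?k g) e \<noteq> 0"
      by (metis lookup_zero poly_mapping_eqI)
    thus "g \<in> monomial_degree p n ` Poly_Mapping.keys f"
      by (auto simp: lookup_degree_part in_keys_iff)
  qed
  hence fin: "finite ?S" by (rule finite_subset) simp
  have zero: "?k g = 0" if "g \<notin> ?S" for g
    using that cls_inject[of n "?k g" 0] by (simp add: cls_hom)
  have "f = sum ?k (monomial_degree p n ` Poly_Mapping.keys f)"
    by (rule sum_degree_part)
  also have "\<dots> = sum ?k ?S"
    by (rule sum.mono_neutral_right[OF _ sub]) (simp, use zero in blast)
  finally have "x = (\<Oplus>\<^bsub>R\<^esub>g\<in>?S. cls n (?k g))"
    using x finsum_cls[OF fin, of n ?k] by simp
  thus ?thesis
    using fin degree_part_in cls_in_component by (intro exI[of _ "\<lambda>g. cls n (?k g)"]) blast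
qed

lemma decomposition_unique:
  assumes "finite {g. u g \<noteq> \<zero>\<^bsub>R\<^esub>}" "\<And>g. u g \<in> component g"
    and "finite {g. v g \<noteq> \<zero>\<^bsub>R\<^esub>}" "\<And>g. v g \<in> component g"
    and eq: "(\<Oplus>\<^bsub>R\<^esub>g\<in>{g. u g \<noteq> \<zero>\<^bsub>R\<^esub>}. u g) = (\<Oplus>\<^bsub>R\<^esub>g\<in>{g. v g \<noteq> \<zero>\<^bsub>R\<^esub>}. v g)"
  shows "u = v"
proof -
  obtain N where N: "\<And>n. N \<le> n \<Longrightarrow> \<exists>f. (\<Oplus>\<^bsub>R\<^esub>g\<in>{g. u g \<noteq> \<zero>\<^bsub>R\<^esub>}. u g) = cls n f \<and> (\<forall>g. u g = cls n (degree_part p n g f))"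
    using decomposition_stage[of u, OF assms(1,2)] by blast
  obtain M where M: "\<And>n. M \<le> n \<Longrightarrow> \<exists>f. (\<Oplus>\<^bsub>R\<^esub>g\<in>{g. v g \<noteq> \<zero>\<^bsub>R\<^esub>}. v g) = cls n f \<and> (\<forall>g. v g = cls n (degree_part p n g f))"
    using decomposition_stage[of v, OF assms(3,4)] by blast
  obtain f where f: "(\<Oplus>\<^bsub>R\<^esub>g\<in>{g. u g \<noteq> \<zero>\<^bsub>R\<^esub>}. u g) = cls (N + M) f"
    "\<forall>g. u g = cls (N + M) (degree_part p (N + M) g f)"
    using N[of "N + M"] le_add1 le_add2 by blast
  obtain h where h: "(\<Oplus>\<^bsub>R\<^esub>g\<in>{g. v g \<noteq> \<zero>\<^bsub>R\<^esub>}. v g) = cls (N + M) h"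
    "\<forall>g. v g = cls (N + M) (degree_part p (N + M) g h)"
    using M[of "N + M"] le_add1 le_add2 by blast
  have "f = h"
    using eq unfolding f(1) h(1) by (rule cls_inject)
  thus ?thesis
    using f(2) h(2) by (intro ext) simp
qed

lemma graded_ring_R: "graded_ring R component"
proof (rule graded_ring.intro[OF is_cring], rule graded_ring_axioms.intro)
  fix g
  show "additive_subgroup (component g) R"
  proof (rule additive_subgroup.intro, rule add.subgroupI)
    show "component g \<subseteq> carrier R" by (rule component_carrier)
    show "component g \<noteq> {}"
      using cls_in_component[OF stage_component_closed(1)] by blast
    show "\<ominus>\<^bsub>R\<^esub> x \<in> component g" if x: "x \<in> component g" for x
    proof -
      obtain n f where "x = cls n f" "f \<in> stage_component p n g"
        using x by (auto simp: R_kd_component_def)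
      thus ?thesis by (simp add: cls_minus cls_in_component stage_component_closed(3))
    qed
    show "x \<oplus>\<^bsub>R\<^esub> y \<in> component g" if "x \<in> component g" "y \<in> component g" for x y
      using that by (rule component_stage2) (simp add: cls_hom cls_in_component stage_component_closed(2))
  qed
next
  fix x y g h assume "x \<in> component g" "y \<in> component h"
  thus "x \<otimes>\<^bsub>R\<^esub> y \<in> component (g + h)"
    by (rule component_stage2) (simp add: cls_hom cls_in_component stage_component_mult)
next
  fix x assume "x \<in> carrier R"
  then obtain u where u: "finite {g. u g \<noteq> \<zero>\<^bsub>R\<^esub>} \<and> (\<forall>g. u g \<in> component g) \<and>
      x = (\<Oplus>\<^bsub>R\<^esub>g\<in>{g. u g \<noteq> \<zero>\<^bsub>R\<^esub>}. u g)"
    using decomposition_exists by blast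
  show "\<exists>!u. finite {g. u g \<noteq> \<zero>\<^bsub>R\<^esub>} \<and> (\<forall>g. u g \<in> component g) \<and>
      x = (\<Oplus>\<^bsub>R\<^esub>g\<in>{g. u g \<noteq> \<zero>\<^bsub>R\<^esub>}. u g)"
  proof (rule ex1I[of _ u], rule u)
    fix v assume v: "finite {g. v g \<noteq> \<zero>\<^bsub>R\<^esub>} \<and> (\<forall>g. v g \<in> component g) \<and>
      x = (\<Oplus>\<^bsub>R\<^esub>g\<in>{g. v g \<noteq> \<zero>\<^bsub>R\<^esub>}. v g)"
    have "(\<Oplus>\<^bsub>R\<^esub>g\<in>{g. v g \<noteq> \<zero>\<^bsub>R\<^esub>}. v g) = (\<Oplus>\<^bsub>R\<^esub>g\<in>{g. u g \<noteq> \<zero>\<^bsub>R\<^esub>}. u g)"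
      using u v by (elim conjE) (rule trans, rule sym)
    with u v show "v = u" by (intro decomposition_unique) blast+
  qed
qed

lemma homogeneous_unit:
  assumes "x \<in> component g" "x \<noteq> \<zero>\<^bsub>R\<^esub>"
  shows "\<exists>y\<in>carrier R. y \<otimes>\<^bsub>R\<^esub> x = \<one>\<^bsub>R\<^esub>"
proof -
  obtain n f where f: "x = cls n f" "f \<in> stage_component p n g"
    using assms(1) by (auto simp: R_kd_component_def)
  have "f \<noteq> 0" using assms(2) f(1) by (auto simp: cls_hom)
  then obtain e where e: "Poly_Mapping.lookup f e \<noteq> 0"
    by (metis lookup_zero poly_mapping_eqI)
  have "d = e" if "Poly_Mapping.lookup f d \<noteq> 0" for d
    using f(2) e that by (intro monomial_degree_inject[of p n, OF p_pos]) (auto simp: stage_component_def in_keys_iff)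
  hence "f = Poly_Mapping.single e (Poly_Mapping.lookup f e)"
    by (intro poly_mapping_eqI) (auto simp: lookup_single when_def)
  hence "Poly_Mapping.single (- e) (inverse (Poly_Mapping.lookup f e)) * f = 1"
    using single_mult_inverse[OF e, of e] by (metis mult.commute)
  thus ?thesis
    by (intro bexI[of _ "cls n (Poly_Mapping.single (- e) (inverse (Poly_Mapping.lookup f e)))"])
      (simp_all add: f(1) cls_hom)
qed

theorem graded_field_R: "graded_field R component"
proof (rule graded_field.intro[OF graded_ring_R], rule graded_field_axioms.intro)
  show "\<one>\<^bsub>R\<^esub> \<noteq> \<zero>\<^bsub>R\<^esub>"
    using cls_inject[of 0 1 0] by (auto simp: cls_hom)
  fix I assume "homogeneous_ideal R component I"
  then obtain S where I: "ideal I R" and S: "S \<subseteq> (\<Union>g. component g)" "I = genideal R S"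
    by (auto simp: homogeneous_ideal_def)
  have Sc: "S \<subseteq> carrier R" using S(1) component_carrier by blast
  show "I = {\<zero>\<^bsub>R\<^esub>} \<or> I = carrier R"
  proof (cases "S \<subseteq> {\<zero>\<^bsub>R\<^esub>}")
    case True
    hence "I \<subseteq> {\<zero>\<^bsub>R\<^esub>}"
      unfolding S(2) by (intro genideal_minimal zeroideal)
    moreover have "\<zero>\<^bsub>R\<^esub> \<in> I"
      using additive_subgroup.zero_closed[OF ideal.axioms(1)[OF I]] .
    ultimately show ?thesis by blast
  next
    case False
    then obtain x g where x: "x \<in> S" "x \<noteq> \<zero>\<^bsub>R\<^esub>" "x \<in> component g"
      using S(1) by blast
    obtain y where "y \<in> carrier R" "y \<otimes>\<^bsub>R\<^esub> x = \<one>\<^bsub>R\<^esub>"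
      using homogeneous_unit[OF x(3,2)] by blast
    moreover have "x \<in> I"
      unfolding S(2) using genideal_self[OF Sc] x(1) by blast
    ultimately have "\<one>\<^bsub>R\<^esub> \<in> I"
      using ideal.I_l_closed[OF I] by metis
    thus ?thesis using ideal.one_imp_carrier[OF I] by blast
  qed
qed

end

theorem theorem4p1:
  fixes p :: "nat \<Rightarrow> nat"
  assumes roots_of_unity:
      "\<And>(z :: ('k::field_char_0) alg_closure) n. n > 0 \<Longrightarrow> z ^ n = 1 \<Longrightarrow> z \<in> range to_ac"
    and primes: "\<And>n. prime (p n)"
    and exhausts: "(UNIV :: rat set) = (\<Union>n. {of_int a / of_nat (\<Prod>m\<le>n. p m) | a. True})"
  shows "graded_field (R_kd p :: (nat \<times> ('k, 'd::{finite,linorder}) laurent) set ring)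
           (R_kd_component p :: rat^('d::{finite,linorder}) \<Rightarrow> _)
       \<and> noetherian_ring (R_kd p :: (nat \<times> ('k, 'd) laurent) set ring)"
proof -
  have pos: "p n > 0" for n
    using primes[of n] by (rule prime_gt_0_nat)
  interpret R_kd_ring p "TYPE('k)" "TYPE('d)"
    by standard (rule pos)
  show ?thesis
    using graded_field_R noetherian_R_kd[of p, OF pos] by blast
qed

end
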